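(* Let $p>3$ be prime, $L=L_{2p^2}$ and $\Gamma=\Gamma_{2p^2}$. If $h(D)$ denotes the class number of discriminant $D$, then the boundary of the Baily-Borel compactification $\mathcal{F}_L(\Gamma)^*$ contains at most $4h(-48p^2)$ curves of type $1$, at most $128\,h(-12p^2)$ curves of type $2$, at most $8a$ curves of type $a=p$, and at most $4a$ curves of type $a=2p$.
   Context: A lattice is a free abelian group of finite rank with a non-degenerate even integral quadratic form $x^2=(x,x)$; $\langle m\rangle$ is the rank 1 lattice generated by an element of length $m$, and $U$ is the hyperbolic plane. $L_{2d}=2U\oplus\langle -2d\rangle\oplus\langle -6\rangle$ (signature $(2,4)$), with $\underline v$, $\underline w$ generators of the $\langle -2d\rangle$ and $\langle -6\rangle$ factors, and $\underline v^*=\underline v/2d\in L_{2d}^\vee$. The real spinor norm is normalised so that the reflection $\sigma_w$ in $w$ has spinor norm $-(w,w)/2\in\mathbb{R}^*/(\mathbb{R}^* )^2$; $\operatorname{O}^+(L\otimes\mathbb{R})$ is its kernel and $\operatorname{O}^+(L)=\operatorname{O}(L)\cap \operatorname{O}^+(L\otimes\mathbb{R})$. Put $\Gamma_{2d}=\{g\in \operatorname{O}^+(L_{2d})\mid g\underline v^*\equiv\underline v^*\bmod L_{2d}\}$. $\mathcal{D}_L$ is the component of $\{[x]\in\mathbb{P}(L\otimes\mathbb{C})\mid (x,x)=0,(x,\overline x)>0\}$ preserved by $\operatorname{O}^+(L\otimes\mathbb{R})$, and $\mathcal{F}_L(\Gamma)=\mathcal{D}_L/\Gamma$. Its Baily-Borel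 compactification $\mathcal{F}_L(\Gamma)^*$ decomposes as $\mathcal{F}_L(\Gamma)\sqcup\bigsqcup_E\mathcal{C}_E\sqcup\bigsqcup_l P_l$, where $E$ (resp. $l$) runs over representatives of $\Gamma$-orbits of primitive totally isotropic sublattices of rank 2 (resp. rank 1) of $L$, each $\mathcal{C}_E$ is a curve and each $P_l$ a point. Thus boundary curves correspond bijectively to $\Gamma$-orbits of primitive totally isotropic rank 2 sublattices $E\subset L$. Type: for every $E$ there is a $\mathbb{Z}$-basis $\{v_1,\dots,v_6\}$ of $L$ with $\{v_1,v_2\}$ a basis of $E$, $\{v_1,\dots,v_4\}$ a basis of $E^\perp$, and $((v_i,v_j))_{i=1,2;\,j=5,6}=\begin{pmatrix}0&a\\1&0\end{pmatrix}$ with $a\in\{1,2,p,2p\}$; $E$ and $\mathcal{C}_E$ are then said to be of type $a$. The class number $h(D)$ is that of integral binary quadratic forms of discriminant $D$. *)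

theory Defs
  imports "HOL-Analysis.Analysis" "HOL-Computational_Algebra.Primes"
begin

section \<open>The lattice \<open>2U \<oplus> \<langle>-2d\<rangle> \<oplus> \<langle>-6\<rangle>\<close>\<close>

text \<open>
  The lattice is the set of integral points of \<open>\<real>\<^sup>6\<close>. The coordinates 1, 2 and 3, 4 belong to the two
  hyperbolic planes, 5 and 6 to the generators \<open>v\<close> and \<open>w\<close> of the rank 1 summands. The form is
  polymorphic so that it is also the complex bilinear extension to \<open>\<complex>\<^sup>6\<close>. In the type \<open>6\<close> the
  index 6 is the same as 0.
\<close>

definition form :: "nat \<Rightarrow> 'a::comm_ring_1 ^ 6 \<Rightarrow> 'a ^ 6 \<Rightarrow> 'a" where
  "form d x y = x$1 * y$2 + x$2 * y$1 + x$3 * y$4 + x$4 * y$3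
     - of_nat (2 * d) * x$5 * y$5 - 6 * x$6 * y$6"

definition lat :: "(real ^ 6) set" where
  "lat = {x. \<forall>i. x$i \<in> \<int>}"

definition vstar :: "nat \<Rightarrow> real ^ 6" where
  "vstar d = (1 / real (2 * d)) *\<^sub>R axis 5 1"


section \<open>Orthogonal groups\<close>

definition O_real :: "nat \<Rightarrow> (real ^ 6 ^ 6) set" where
  "O_real d = {g. \<forall>x y. form d (g *v x) (g *v y) = form d x y}"

definition refl_mat :: "nat \<Rightarrow> real ^ 6 \<Rightarrow> real ^ 6 ^ 6" where
  "refl_mat d w = matrix (\<lambda>x. x - (2 * form d x w / form d w w) *\<^sub>R w)"

text \<open>
  The real spinor norm, as a relation: \<open>g\<close> is written as a product of reflections, and each
  reflection in \<open>w\<close> contributes \<open>-(w,w)/2\<close>. The group of nonzero reals modulo squares is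
  identified with \<open>{1, -1}\<close> through the sign.
\<close>

definition has_spinor_norm :: "nat \<Rightarrow> real ^ 6 ^ 6 \<Rightarrow> real \<Rightarrow> bool" where
  "has_spinor_norm d g s \<longleftrightarrow>
     (\<exists>ws. (\<forall>w\<in>set ws. form d w w \<noteq> 0) \<and>
           g = foldr (\<lambda>w h. refl_mat d w ** h) ws (mat 1) \<and>
           s = sgn (\<Prod>w\<leftarrow>ws. - form d w w / 2))"

definition O_plus_real :: "nat \<Rightarrow> (real ^ 6 ^ 6) set" where
  "O_plus_real d = {g \<in> O_real d. has_spinor_norm d g 1}"

definition O_lat :: "nat \<Rightarrow> (real ^ 6 ^ 6) set" where
  "O_lat d = {g \<in> O_real d. (\<lambda>x. g *v x) ` lat = lat}"

definition O_plus_lat :: "nat \<Rightarrow> (real ^ 6 ^ 6) set" where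
  "O_plus_lat d = O_lat d \<inter> O_plus_real d"

definition Gamma :: "nat \<Rightarrow> (real ^ 6 ^ 6) set" where
  "Gamma d = {g \<in> O_plus_lat d. g *v vstar d - vstar d \<in> lat}"


section \<open>Projective space and the period domain\<close>

text \<open>Points of the projective space are the complex lines through 0, as subsets of \<open>\<complex>\<^sup>6\<close>.\<close>

definition proj :: "complex ^ 6 \<Rightarrow> (complex ^ 6) set" where
  "proj x = range (\<lambda>c. c *s x)"

definition proj_space :: "(complex ^ 6) set set" where
  "proj_space = proj ` (- {0})"

text \<open>The quotient topology.\<close>

definition proj_top :: "(complex ^ 6) set topology" where
  "proj_top = topology (\<lambda>U. U \<subseteq> proj_space \<and> open {x. x \<noteq> 0 \<and> proj x \<in> U})"

lemma openin_proj_top: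
  "openin proj_top U \<longleftrightarrow> U \<subseteq> proj_space \<and> open {x. x \<noteq> 0 \<and> proj x \<in> U}"
proof -
  have "istopology (\<lambda>U. U \<subseteq> proj_space \<and> open {x. x \<noteq> 0 \<and> proj x \<in> U})"
    unfolding istopology_def
  proof (rule conjI; clarify)
    fix S T :: "(complex ^ 6) set set"
    assume "open {x. x \<noteq> 0 \<and> proj x \<in> S}" "open {x. x \<noteq> 0 \<and> proj x \<in> T}"
    then have "open ({x. x \<noteq> 0 \<and> proj x \<in> S} \<inter> {x. x \<noteq> 0 \<and> proj x \<in> T})" by blast
    moreover have "{x. x \<noteq> 0 \<and> proj x \<in> S} \<inter> {x. x \<noteq> 0 \<and> proj x \<in> T}
      = {x. x \<noteq> 0 \<and> proj x \<in> S \<inter> T}" by blast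
    moreover assume "S \<subseteq> proj_space"
    ultimately show "S \<inter> T \<subseteq> proj_space \<and> open {x. x \<noteq> 0 \<and> proj x \<in> S \<inter> T}" by auto
  next
    fix K :: "(complex ^ 6) set set set"
    assume K: "\<forall>U\<in>K. U \<subseteq> proj_space \<and> open {x. x \<noteq> 0 \<and> proj x \<in> U}"
    then have "open (\<Union>U\<in>K. {x. x \<noteq> 0 \<and> proj x \<in> U})" by blast
    moreover have "(\<Union>U\<in>K. {x. x \<noteq> 0 \<and> proj x \<in> U}) = {x. x \<noteq> 0 \<and> proj x \<in> \<Union> K}" by blast
    ultimately show "\<Union> K \<subseteq> proj_space \<and> open {x. x \<noteq> 0 \<and> proj x \<in> \<Union> K}" using K by auto
  qed
  then show ?thesis by (simp add: proj_top_def)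
qed

definition conj_vec :: "complex ^ 6 \<Rightarrow> complex ^ 6" where
  "conj_vec x = (\<chi> i. cnj (x$i))"

text \<open>\<open>(x, conj x)\<close> is always real; \<open>Re\<close> only serves to compare it with 0.\<close>

definition positive_quadric :: "nat \<Rightarrow> (complex ^ 6) set set" where
  "positive_quadric d =
     {proj x | x. x \<noteq> 0 \<and> form d x x = 0 \<and> Re (form d x (conj_vec x)) > 0}"

definition act :: "real ^ 6 ^ 6 \<Rightarrow> (complex ^ 6) set \<Rightarrow> (complex ^ 6) set" where
  "act g P = (\<lambda>x. map_matrix complex_of_real g *v x) ` P"

definition is_period_domain :: "nat \<Rightarrow> (complex ^ 6) set set \<Rightarrow> bool" where
  "is_period_domain d D \<longleftrightarrow>
     D \<in> connected_components_of (subtopology proj_top (positive_quadric d)) \<and>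
     (\<forall>g\<in>O_plus_real d. act g ` D = D)"


section \<open>Primitive totally isotropic sublattices\<close>

text \<open>The rank of a subgroup of the lattice is the dimension of its real span.\<close>

definition prim_isotropic :: "nat \<Rightarrow> nat \<Rightarrow> (real ^ 6) set \<Rightarrow> bool" where
  "prim_isotropic d r E \<longleftrightarrow>
     E \<subseteq> lat \<and> 0 \<in> E \<and> (\<forall>x\<in>E. \<forall>y\<in>E. x - y \<in> E) \<and>
     (\<forall>x\<in>lat. \<forall>n::int. n \<noteq> 0 \<longrightarrow> of_int n *\<^sub>R x \<in> E \<longrightarrow> x \<in> E) \<and>
     (\<forall>x\<in>E. \<forall>y\<in>E. form d x y = 0) \<and>
     dim E = r"

definition perp :: "nat \<Rightarrow> (real ^ 6) set \<Rightarrow> (real ^ 6) set" where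
  "perp d E = {x \<in> lat. \<forall>y\<in>E. form d x y = 0}"

definition int_basis :: "(nat \<Rightarrow> real ^ 6) \<Rightarrow> nat set \<Rightarrow> (real ^ 6) set \<Rightarrow> bool" where
  "int_basis v I M \<longleftrightarrow>
     M = range (\<lambda>c::nat \<Rightarrow> int. \<Sum>i\<in>I. of_int (c i) *\<^sub>R v i) \<and>
     (\<forall>c::nat \<Rightarrow> int. (\<Sum>i\<in>I. of_int (c i) *\<^sub>R v i) = 0 \<longrightarrow> (\<forall>i\<in>I. c i = 0))"

definition has_type :: "nat \<Rightarrow> nat \<Rightarrow> (real ^ 6) set \<Rightarrow> bool" where
  "has_type d a E \<longleftrightarrow>
     (\<exists>v. int_basis v {1..6} lat \<and> int_basis v {1..2} E \<and> int_basis v {1..4} (perp d E) \<and>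
          form d (v 1) (v 5) = 0 \<and> form d (v 1) (v 6) = real a \<and>
          form d (v 2) (v 5) = 1 \<and> form d (v 2) (v 6) = 0)"


section \<open>The Baily-Borel compactification\<close>

definition complexify :: "(real ^ 6) set \<Rightarrow> (complex ^ 6) set" where
  "complexify E = {x. (\<chi> i. Re (x$i)) \<in> span E \<and> (\<chi> i. Im (x$i)) \<in> span E}"

text \<open>
  The rational boundary component of \<open>D\<close> attached to \<open>E\<close> of rank 2: the non-real points of
  \<open>\<P>(E \<otimes> \<complex>)\<close> in the closure of \<open>D\<close>. The non-real points form two half planes, of which
  exactly one lies in this closure.
\<close>

definition bd_curve :: "(complex ^ 6) set set \<Rightarrow> (real ^ 6) set \<Rightarrow> (complex ^ 6) set set" where
  "bd_curve D E = {proj x | x. x \<in> complexify E \<and> x \<noteq> 0 \<and> proj x \<noteq> proj (conj_vec x)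
                             \<and> proj x \<in> proj_top closure_of D}"

text \<open>For \<open>l\<close> of rank 1 this set consists of a single point.\<close>

definition bd_point :: "(real ^ 6) set \<Rightarrow> (complex ^ 6) set set" where
  "bd_point l = {proj x | x. x \<in> complexify l \<and> x \<noteq> 0}"

definition extended_domain :: "nat \<Rightarrow> (complex ^ 6) set set \<Rightarrow> (complex ^ 6) set set" where
  "extended_domain d D =
     D \<union> (\<Union>E\<in>{E. prim_isotropic d 2 E}. bd_curve D E) \<union> (\<Union>l\<in>{l. prim_isotropic d 1 l}. bd_point l)"

definition orbit_rel ::
    "(real ^ 6 ^ 6) set \<Rightarrow> (complex ^ 6) set set \<Rightarrow> ((complex ^ 6) set \<times> (complex ^ 6) set) set" where
  "orbit_rel G X = {(P, Q). P \<in> X \<and> Q \<in> X \<and> (\<exists>g\<in>G. Q = act g P)}"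

text \<open>
  The underlying set of the compactification is the quotient of the extended domain by the group.
  For a subset \<open>Y\<close> of the extended domain, \<open>Y // orbit_rel G (extended_domain d D)\<close> is its image
  in the compactification.
\<close>

definition modular_variety ::
    "nat \<Rightarrow> (real ^ 6 ^ 6) set \<Rightarrow> (complex ^ 6) set set \<Rightarrow> (complex ^ 6) set set set" where
  "modular_variety d G D = D // orbit_rel G (extended_domain d D)"

definition baily_borel ::
    "nat \<Rightarrow> (real ^ 6 ^ 6) set \<Rightarrow> (complex ^ 6) set set \<Rightarrow> (complex ^ 6) set set set" where
  "baily_borel d G D = extended_domain d D // orbit_rel G (extended_domain d D)"

definition cusp_curve ::
    "nat \<Rightarrow> (real ^ 6 ^ 6) set \<Rightarrow> (complex ^ 6) set set \<Rightarrow> (real ^ 6) set \<Rightarrow> (complex ^ 6) set set set" where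
  "cusp_curve d G D E = bd_curve D E // orbit_rel G (extended_domain d D)"

definition cusp_point ::
    "nat \<Rightarrow> (real ^ 6 ^ 6) set \<Rightarrow> (complex ^ 6) set set \<Rightarrow> (real ^ 6) set \<Rightarrow> (complex ^ 6) set set set" where
  "cusp_point d G D l = bd_point l // orbit_rel G (extended_domain d D)"

lemma baily_borel_decomposition:
  "baily_borel d G D =
     modular_variety d G D \<union> (\<Union>E\<in>{E. prim_isotropic d 2 E}. cusp_curve d G D E)
       \<union> (\<Union>l\<in>{l. prim_isotropic d 1 l}. cusp_point d G D l)"
proof -
  let ?r = "orbit_rel G (extended_domain d D)"
  have "baily_borel d G D = (\<lambda>P. ?r `` {P}) ` extended_domain d D"
    by (auto simp: baily_borel_def quotient_def)
  also have "\<dots> = modular_variety d G D \<union> (\<Union>E\<in>{E. prim_isotropic d 2 E}. cusp_curve d G D E)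
       \<union> (\<Union>l\<in>{l. prim_isotropic d 1 l}. cusp_point d G D l)"
    unfolding modular_variety_def cusp_curve_def cusp_point_def quotient_def
    by (subst (2) extended_domain_def) blast
  finally show ?thesis .
qed

definition boundary_curves_of_type ::
    "nat \<Rightarrow> (real ^ 6 ^ 6) set \<Rightarrow> (complex ^ 6) set set \<Rightarrow> nat \<Rightarrow> (complex ^ 6) set set set set" where
  "boundary_curves_of_type d G D a =
     {cusp_curve d G D E | E. prim_isotropic d 2 E \<and> has_type d a E}"


section \<open>Class numbers\<close>

text \<open>
  The triple \<open>(a, b, c)\<close> stands for \<open>a x\<^sup>2 + b x y + c y\<^sup>2\<close>. The class number counts proper
  equivalence classes of primitive positive definite forms; it is only meant for \<open>D < 0\<close>.
\<close>

fun bqf :: "int \<times> int \<times> int \<Rightarrow> int \<Rightarrow> int \<Rightarrow> int" where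
  "bqf (a, b, c) x y = a * x^2 + b * x * y + c * y^2"

definition bqf_forms :: "int \<Rightarrow> (int \<times> int \<times> int) set" where
  "bqf_forms D = {(a, b, c). b^2 - 4 * a * c = D \<and> gcd a (gcd b c) = 1 \<and>
                     (\<forall>x y. (x, y) \<noteq> (0, 0) \<longrightarrow> bqf (a, b, c) x y > 0)}"

definition bqf_equiv :: "int \<Rightarrow> ((int \<times> int \<times> int) \<times> (int \<times> int \<times> int)) set" where
  "bqf_equiv D = {(f, g). f \<in> bqf_forms D \<and> g \<in> bqf_forms D \<and>
     (\<exists>\<alpha> \<beta> \<gamma> \<delta>. \<alpha> * \<delta> - \<beta> * \<gamma> = 1 \<and>
        (\<forall>x y. bqf g x y = bqf f (\<alpha> * x + \<beta> * y) (\<gamma> * x + \<delta> * y)))}"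

definition class_number :: "int \<Rightarrow> nat" where
  "class_number D = card (bqf_forms D // bqf_equiv D)"

end

theory Submission
  imports Defs
begin

text \<open>
  Let \<open>E\<close> have type \<open>a\<close>. The lattice \<open>E\<^sup>\<bottom>/E\<close> is negative definite of rank 2 and determinant \<open>12p\<^sup>2/a\<^sup>2\<close>,
  which is prime to \<open>a\<close>. Hence the mixed entries of the Gram matrix of an adapted basis can be
  cleared, and up to \<open>O(L)\<close> the plane \<open>E\<close> is determined by the class of a positive definite binary
  form of discriminant \<open>-12p\<^sup>2/a\<^sup>2\<close>, possibly imprimitive, and an integer \<open>0 \<le> k < a\<close>.

  Passing from \<open>O(L)\<close> to \<open>\<Gamma>\<close> costs nothing: every isometry of \<open>L\<close> maps \<open>v\<^sup>*\<close> to \<open>\<plusminus>v\<^sup>*\<close> modulo \<open>L\<close>, \<open>-1\<close>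
  has spinor norm 1, and \<open>-1\<close> on a hyperbolic plane of a normal form is an isometry of spinor norm
  \<open>-1\<close> preserving \<open>E\<close>. So there are at most \<open>a\<close> times as many curves of type \<open>a\<close> as classes of forms.

  Sorting forms by content and using \<open>h(D) \<le> h(q\<^sup>2D)\<close> for primes \<open>q\<close>, the number of classes is at
  most \<open>4h(-48p\<^sup>2)\<close> for \<open>a = 1\<close> and \<open>2h(-12p\<^sup>2)\<close> for \<open>a = 2\<close>; for \<open>a = p\<close> and \<open>a = 2p\<close> the discriminants
  are \<open>-12\<close> and \<open>-3\<close>, with at most 3 and 2 reduced forms.
\<close>

section \<open>Binary quadratic forms\<close>

text \<open>The type of \<open>E\<close> prescribes only how \<open>E\<close> pairs with two
  complementary vectors; the discriminant of the remaining binary form has to be extracted from a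
  determinant. A lattice basis has determinant of square 1 and the form itself has determinant
  12p^2, so the forms for a = 1, 2, p, 2p have discriminants -12p^2, -3p^2, -12, -3. The coprimality
  to a, which uses p > 3, makes the Gram matrix of the binary part invertible modulo a. The integer
  k is half the norm of the vector dual to a primitive vector of \<open>E\<close> up to the factor
  a; that norm can be shifted only by multiples of 2a, hence the factor a in every bound.

  Two obstacles shape the rest. The class number counts primitive forms only, while the binary form
  may have content, so class numbers of different discriminants must be compared. And
  \<open>has_spinor_norm\<close> asserts a factorisation into reflections, so the theorem of Cartan
  and Dieudonne is proved before a spinor norm can be attributed to an isometry obtained from Gram
  matrices.\<close>

definition bqf_disc :: "int \<times> int \<times> int \<Rightarrow> int" where
  "bqf_disc = (\<lambda>(a, b, c). b^2 - 4 * a * c)"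

definition bqf_posdef :: "int \<times> int \<times> int \<Rightarrow> bool" where
  "bqf_posdef f \<longleftrightarrow> (\<forall>x y. (x, y) \<noteq> (0, 0) \<longrightarrow> bqf f x y > 0)"

definition bqf_content :: "int \<times> int \<times> int \<Rightarrow> int" where
  "bqf_content = (\<lambda>(a, b, c). gcd a (gcd b c))"

definition bqf_posdef_forms :: "int \<Rightarrow> (int \<times> int \<times> int) set" where
  "bqf_posdef_forms D = {f. bqf_disc f = D \<and> bqf_posdef f}"

definition proper_equiv :: "int \<times> int \<times> int \<Rightarrow> int \<times> int \<times> int \<Rightarrow> bool" where
  "proper_equiv f g \<longleftrightarrow> (\<exists>\<alpha> \<beta> \<gamma> \<delta>. \<alpha> * \<delta> - \<beta> * \<gamma> = 1 \<and>
     (\<forall>x y. bqf g x y = bqf f (\<alpha> * x + \<beta> * y) (\<gamma> * x + \<delta> * y)))"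

fun bqf_subst :: "int \<Rightarrow> int \<Rightarrow> int \<Rightarrow> int \<Rightarrow> int \<times> int \<times> int \<Rightarrow> int \<times> int \<times> int" where
  "bqf_subst \<alpha> \<beta> \<gamma> \<delta> (a, b, c) =
     (a * \<alpha>^2 + b * \<alpha> * \<gamma> + c * \<gamma>^2,
      2 * a * \<alpha> * \<beta> + b * (\<alpha> * \<delta> + \<beta> * \<gamma>) + 2 * c * \<gamma> * \<delta>,
      a * \<beta>^2 + b * \<beta> * \<delta> + c * \<delta>^2)"

lemma bqf_forms_iff:
  "f \<in> bqf_forms D \<longleftrightarrow> f \<in> bqf_posdef_forms D \<and> bqf_content f = 1"
  by (cases f) (auto simp: bqf_forms_def bqf_posdef_forms_def bqf_disc_def bqf_posdef_def
      bqf_content_def)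

lemma bqf_equiv_iff:
  "(f, g) \<in> bqf_equiv D \<longleftrightarrow> f \<in> bqf_forms D \<and> g \<in> bqf_forms D \<and> proper_equiv f g"
  by (simp add: bqf_equiv_def proper_equiv_def)

lemma bqf_bqf_subst:
  "bqf (bqf_subst \<alpha> \<beta> \<gamma> \<delta> f) x y = bqf f (\<alpha> * x + \<beta> * y) (\<gamma> * x + \<delta> * y)"
  by (cases f) (simp add: power2_eq_square algebra_simps)

lemma bqf_eqI:
  assumes "\<And>x y. bqf f x y = bqf g x y"
  shows "f = g"
  using assms[of 1 0] assms[of 0 1] assms[of 1 1] by (cases f; cases g) auto

text \<open>A form is determined by its values at (1,0), (0,1), (1,1), so equivalence stated through
  values is the same as substitution in the coefficients.\<close>

lemma proper_equiv_iff:
  "proper_equiv f g \<longleftrightarrow> (\<exists>\<alpha> \<beta> \<gamma> \<delta>. \<alpha> * \<delta> - \<beta> * \<gamma> = 1 \<and> g = bqf_subst \<alpha> \<beta> \<gamma> \<delta> f)"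
  unfolding proper_equiv_def by (metis bqf_bqf_subst bqf_eqI)

lemma proper_equivI: "\<alpha> * \<delta> - \<beta> * \<gamma> = 1 \<Longrightarrow> proper_equiv f (bqf_subst \<alpha> \<beta> \<gamma> \<delta> f)"
  using proper_equiv_iff by blast

lemma proper_equiv_refl: "proper_equiv f f"
  unfolding proper_equiv_def by (rule exI[of _ 1], rule exI[of _ 0], rule exI[of _ 0], rule exI[of _ 1]) simp

lemma proper_equiv_sym:
  assumes "proper_equiv f g"
  shows "proper_equiv g f"
proof -
  obtain \<alpha> \<beta> \<gamma> \<delta> where det: "\<alpha> * \<delta> - \<beta> * \<gamma> = 1"
    and g: "\<And>x y. bqf g x y = bqf f (\<alpha> * x + \<beta> * y) (\<gamma> * x + \<delta> * y)"
    using assms unfolding proper_equiv_def by blast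
  have "bqf f x y = bqf g (\<delta> * x + (- \<beta>) * y) (- \<gamma> * x + \<alpha> * y)" for x y
  proof -
    have "\<alpha> * (\<delta> * x + (- \<beta>) * y) + \<beta> * (- \<gamma> * x + \<alpha> * y) = (\<alpha> * \<delta> - \<beta> * \<gamma>) * x"
      "\<gamma> * (\<delta> * x + (- \<beta>) * y) + \<delta> * (- \<gamma> * x + \<alpha> * y) = (\<alpha> * \<delta> - \<beta> * \<gamma>) * y"
      by (simp_all add: algebra_simps)
    then show ?thesis by (simp add: g det)
  qed
  moreover have "\<delta> * \<alpha> - (- \<beta>) * (- \<gamma>) = 1" using det by (simp add: algebra_simps)
  ultimately show ?thesis unfolding proper_equiv_def by blast
qed

lemma proper_equiv_trans:
  assumes "proper_equiv f g" "proper_equiv g h"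
  shows "proper_equiv f h"
proof -
  obtain \<alpha> \<beta> \<gamma> \<delta> where det: "\<alpha> * \<delta> - \<beta> * \<gamma> = 1"
    and g: "\<And>x y. bqf g x y = bqf f (\<alpha> * x + \<beta> * y) (\<gamma> * x + \<delta> * y)"
    using assms(1) unfolding proper_equiv_def by blast
  obtain \<alpha>' \<beta>' \<gamma>' \<delta>' where det': "\<alpha>' * \<delta>' - \<beta>' * \<gamma>' = 1"
    and h: "\<And>x y. bqf h x y = bqf g (\<alpha>' * x + \<beta>' * y) (\<gamma>' * x + \<delta>' * y)"
    using assms(2) unfolding proper_equiv_def by blast
  have "(\<alpha> * \<alpha>' + \<beta> * \<gamma>') * (\<gamma> * \<beta>' + \<delta> * \<delta>') - (\<alpha> * \<beta>' + \<beta> * \<delta>') * (\<gamma> * \<alpha>' + \<delta> * \<gamma>')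
      = (\<alpha> * \<delta> - \<beta> * \<gamma>) * (\<alpha>' * \<delta>' - \<beta>' * \<gamma>')"
    by (simp add: algebra_simps)
  moreover have "bqf h x y = bqf f ((\<alpha> * \<alpha>' + \<beta> * \<gamma>') * x + (\<alpha> * \<beta>' + \<beta> * \<delta>') * y)
      ((\<gamma> * \<alpha>' + \<delta> * \<gamma>') * x + (\<gamma> * \<beta>' + \<delta> * \<delta>') * y)" for x y
    by (simp add: g h algebra_simps)
  ultimately show ?thesis unfolding proper_equiv_def using det det' by (metis mult_1)
qed

lemma bqf_disc_subst:
  "bqf_disc (bqf_subst \<alpha> \<beta> \<gamma> \<delta> f) = (\<alpha> * \<delta> - \<beta> * \<gamma>)^2 * bqf_disc f"
  by (cases f) (simp add: bqf_disc_def power2_eq_square algebra_simps)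

lemma bqf_posdef_subst:
  assumes "bqf_posdef f" "\<alpha> * \<delta> - \<beta> * \<gamma> = 1"
  shows "bqf_posdef (bqf_subst \<alpha> \<beta> \<gamma> \<delta> f)"
  unfolding bqf_posdef_def bqf_bqf_subst
proof (intro allI impI)
  fix x y :: int assume nz: "(x, y) \<noteq> (0, 0)"
  have "(\<alpha> * x + \<beta> * y, \<gamma> * x + \<delta> * y) \<noteq> (0, 0)"
  proof
    assume 0: "(\<alpha> * x + \<beta> * y, \<gamma> * x + \<delta> * y) = (0, 0)"
    have "(\<alpha> * \<delta> - \<beta> * \<gamma>) * x = \<delta> * (\<alpha> * x + \<beta> * y) - \<beta> * (\<gamma> * x + \<delta> * y)"
      "(\<alpha> * \<delta> - \<beta> * \<gamma>) * y = \<alpha> * (\<gamma> * x + \<delta> * y) - \<gamma> * (\<alpha> * x + \<beta> * y)"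
      by (simp_all add: algebra_simps)
    then show False using 0 assms(2) nz by auto
  qed
  then show "bqf f (\<alpha> * x + \<beta> * y) (\<gamma> * x + \<delta> * y) > 0"
    using assms(1) unfolding bqf_posdef_def by blast
qed

lemma proper_equiv_posdef_forms:
  assumes "proper_equiv f g" "f \<in> bqf_posdef_forms D"
  shows "g \<in> bqf_posdef_forms D"
  using assms unfolding proper_equiv_iff bqf_posdef_forms_def
  by (auto simp: bqf_disc_subst intro: bqf_posdef_subst)

text \<open>Describing the content through values makes its invariance under substitution immediate.
  The middle coefficient is f(1,1) - f(1,0) - f(0,1).\<close>

lemma dvd_bqf_content_iff: "n dvd bqf_content f \<longleftrightarrow> (\<forall>x y. n dvd bqf f x y)"
proof (cases f)
  case (fields a b c)
  show ?thesis
  proof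
    assume "n dvd bqf_content f"
    then show "\<forall>x y. n dvd bqf f x y" by (simp add: fields bqf_content_def)
  next
    assume *: "\<forall>x y. n dvd bqf f x y"
    have "n dvd a" "n dvd c" "n dvd a + b + c"
      using *[rule_format, of 1 0] *[rule_format, of 0 1] *[rule_format, of 1 1]
      by (simp_all add: fields)
    then have "n dvd b" by (metis dvd_add_left_iff dvd_add_right_iff)
    then show "n dvd bqf_content f" using \<open>n dvd a\<close> \<open>n dvd c\<close> by (simp add: fields bqf_content_def)
  qed
qed

lemma bqf_content_nonneg: "bqf_content f \<ge> 0"
  by (cases f) (simp add: bqf_content_def)

lemma proper_equiv_content:
  assumes "proper_equiv f g"
  shows "bqf_content f = bqf_content g"
proof -
  have "bqf_content f dvd bqf_content g" if "proper_equiv f g" for f g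
    using that unfolding dvd_bqf_content_iff[of _ g] proper_equiv_def
    by (metis dvd_bqf_content_iff dvd_refl)
  then show ?thesis
    using assms proper_equiv_sym by (metis bqf_content_nonneg zdvd_antisym_nonneg)
qed

lemma proper_equiv_forms:
  "proper_equiv f g \<Longrightarrow> f \<in> bqf_forms D \<Longrightarrow> g \<in> bqf_forms D"
  by (metis bqf_forms_iff proper_equiv_content proper_equiv_posdef_forms)

lemma equiv_bqf_equiv: "equiv (bqf_forms D) (bqf_equiv D)"
proof (rule equivI)
  show "bqf_equiv D \<subseteq> bqf_forms D \<times> bqf_forms D" by (auto simp: bqf_equiv_iff)
  show "refl_on (bqf_forms D) (bqf_equiv D)"
    by (auto simp: refl_on_def bqf_equiv_iff proper_equiv_refl)
  show "sym (bqf_equiv D)" by (auto simp: sym_def bqf_equiv_iff proper_equiv_sym)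
  show "trans (bqf_equiv D)" unfolding trans_def bqf_equiv_iff by (blast intro: proper_equiv_trans)
qed

lemma bqf_posdef_coeffs_pos:
  assumes "bqf_posdef (a, b, c)"
  shows "a > 0" "c > 0"
  using assms[unfolded bqf_posdef_def, rule_format, of 1 0]
    assms[unfolded bqf_posdef_def, rule_format, of 0 1] by auto

section \<open>Gauss reduction and finiteness of the class number\<close>

definition bqf_reduced :: "int \<times> int \<times> int \<Rightarrow> bool" where
  "bqf_reduced = (\<lambda>(a, b, c). \<bar>b\<bar> \<le> a \<and> a \<le> c)"

lemma ex_reduced:
  assumes "bqf_posdef f"
  shows "\<exists>g. proper_equiv f g \<and> bqf_reduced g"
proof -
  obtain h where h: "proper_equiv f h"
    and least: "\<And>g. proper_equiv f g \<Longrightarrow> nat (fst h) \<le> nat (fst g)"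
    using ex_has_least_nat[of "proper_equiv f" f "\<lambda>g. nat (fst g)"] proper_equiv_refl by blast
  obtain a b c where habc: "h = (a, b, c)" by (cases h)
  have pd: "bqf_posdef g" if "proper_equiv f g" for g
    using proper_equiv_posdef_forms[OF that, of "bqf_disc f"] assms
    by (simp add: bqf_posdef_forms_def)
  have a: "a > 0" using bqf_posdef_coeffs_pos(1) pd[OF h] habc by blast
  \<comment> \<open>The translation x -> x + t y adds 2at to the middle coefficient; with this
    \<open>t\<close> the number \<open>b' + a\<close> is the remainder of b + a modulo 2a, so -a
    \<le> b' < a.\<close>
  define t where "t = - ((b + a) div (2 * a))"
  define b' where "b' = 2 * a * t + b"
  define c' where "c' = a * t^2 + b * t + c"
  have "(b + a) mod (2 * a) = b' + a"
    unfolding b'_def t_def by (simp add: minus_mult_div_eq_mod[symmetric] algebra_simps)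
  then have b': "0 \<le> b' + a" "b' + a < 2 * a"
    using pos_mod_sign[of "2 * a" "b + a"] pos_mod_bound[of "2 * a" "b + a"] a by simp_all
  have "proper_equiv h (bqf_subst 1 t 0 1 h)" by (rule proper_equivI) simp
  moreover have "bqf_subst 1 t 0 1 h = (a, b', c')"
    by (simp add: habc b'_def c'_def power2_eq_square algebra_simps)
  ultimately have e1: "proper_equiv f (a, b', c')" using h proper_equiv_trans by metis
  \<comment> \<open>The quarter turn exchanges the outer coefficients, so minimality of
    \<open>a\<close> in the class gives a \<le> c'.\<close>
  have "proper_equiv (a, b', c') (bqf_subst 0 1 (-1) 0 (a, b', c'))" by (rule proper_equivI) simp
  moreover have "bqf_subst 0 1 (-1) 0 (a, b', c') = (c', - b', a)" by simp
  ultimately have "proper_equiv f (c', - b', a)" using e1 proper_equiv_trans by metis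
  from least[OF this] have "nat a \<le> nat c'" by (simp add: habc)
  then have "a \<le> c'" using a by linarith
  then have "bqf_reduced (a, b', c')" using b' by (simp add: bqf_reduced_def)
  with e1 show ?thesis by blast
qed

text \<open>The classical estimate: b^2 \<le> a^2 \<le> ac, hence -D = 4ac - b^2 is at least 3a^2.
  It leaves finitely many pairs (a, b), and these determine c.\<close>

lemma reduced_bounds:
  assumes "(a, b, c) \<in> bqf_posdef_forms D" "bqf_reduced (a, b, c)"
  shows "0 < a" "3 * a^2 \<le> - D" "\<bar>b\<bar> \<le> a" "4 * a * c = b^2 - D"
proof -
  have pd: "bqf_posdef (a, b, c)" and D: "b^2 - 4 * a * c = D"
    using assms(1) by (simp_all add: bqf_posdef_forms_def bqf_disc_def)
  show a: "0 < a" using bqf_posdef_coeffs_pos(1)[OF pd] .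
  show b: "\<bar>b\<bar> \<le> a" using assms(2) by (simp add: bqf_reduced_def)
  show "4 * a * c = b^2 - D" using D by simp
  have "b^2 \<le> a^2" using b abs_le_square_iff a by fastforce
  moreover have "a^2 \<le> a * c"
    using assms(2) a by (simp add: bqf_reduced_def power2_eq_square mult_left_mono)
  ultimately show "3 * a^2 \<le> - D" using D by simp
qed

lemma finite_reduced: "finite {f \<in> bqf_posdef_forms D. bqf_reduced f}"
proof (rule finite_subset)
  let ?F = "\<lambda>(a, b). (a, b, (b^2 - D) div (4 * a))"
  show "{f \<in> bqf_posdef_forms D. bqf_reduced f} \<subseteq> ?F ` ({0..\<bar>D\<bar>} \<times> {-\<bar>D\<bar>..\<bar>D\<bar>})"
  proof
    fix f assume f: "f \<in> {f \<in> bqf_posdef_forms D. bqf_reduced f}"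
    obtain a b c where abc: "f = (a, b, c)" by (cases f)
    note r = reduced_bounds[of a b c D]
    have r': "0 < a" "3 * a^2 \<le> - D" "\<bar>b\<bar> \<le> a" "4 * a * c = b^2 - D"
      using r f abc by auto
    have "a \<le> a^2" using r'(1) by (simp add: power2_eq_square)
    then have "a \<le> \<bar>D\<bar>" using r' by (smt (verit))
    moreover have "c = (b^2 - D) div (4 * a)" using r'(1,4) by (metis nonzero_mult_div_cancel_left mult_eq_0_iff less_irrefl zero_neq_numeral)
    ultimately show "f \<in> ?F ` ({0..\<bar>D\<bar>} \<times> {-\<bar>D\<bar>..\<bar>D\<bar>})"
      using r'(1,3) by (auto simp: abc image_iff intro!: bexI[of _ "(a, b)"])
  qed
qed auto

text \<open>Since \<open>card\<close> is 0 on infinite sets, the estimates from and between class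
  numbers below rest on this.\<close>

lemma finite_classes: "finite (bqf_forms D // bqf_equiv D)"
proof (rule finite_subset)
  show "bqf_forms D // bqf_equiv D
      \<subseteq> (\<lambda>f. bqf_equiv D `` {f}) ` {f \<in> bqf_posdef_forms D. bqf_reduced f}"
  proof
    fix q assume "q \<in> bqf_forms D // bqf_equiv D"
    then obtain f where f: "f \<in> bqf_forms D" "q = bqf_equiv D `` {f}" by (auto elim: quotientE)
    have "bqf_posdef f" using f by (simp add: bqf_forms_iff bqf_posdef_forms_def)
    then obtain g where g: "proper_equiv f g" "bqf_reduced g" using ex_reduced by blast
    have "g \<in> bqf_forms D" using proper_equiv_forms g f by blast
    then have "q = bqf_equiv D `` {g}"
      using equiv_class_eq[OF equiv_bqf_equiv, of f g D] f g by (simp add: bqf_equiv_iff)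
    then show "q \<in> (\<lambda>f. bqf_equiv D `` {f}) ` {f \<in> bqf_posdef_forms D. bqf_reduced f}"
      using \<open>g \<in> bqf_forms D\<close> g by (auto simp: bqf_forms_iff)
  qed
qed (use finite_reduced in simp)

section \<open>Class numbers of D and of its multiple by a prime square\<close>

lemma ex_coprime_leading_coeff:
  assumes "f \<in> bqf_forms D" "prime q"
  shows "\<exists>g. proper_equiv f g \<and> \<not> q dvd fst g"
proof -
  obtain a b c where abc: "f = (a, b, c)" by (cases f)
  \<comment> \<open>If q divided f(1,0), f(0,1) and f(1,1), it would divide the content. The
    substitutions below make the good value the leading coefficient.\<close>
  have "\<not> q dvd gcd a (gcd b c)"
    using assms by (auto simp: bqf_forms_iff abc bqf_content_def)
  then consider "\<not> q dvd a" | "\<not> q dvd c" | "\<not> q dvd a + b + c"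
    by (metis dvd_add_left_iff dvd_add_right_iff gcd_greatest)
  then show ?thesis
  proof cases
    case 1
    then show ?thesis using abc proper_equiv_refl by (intro exI[of _ f]) simp
  next
    case 2
    then show ?thesis
      by (intro exI[of _ "bqf_subst 0 1 (-1) 0 f"] conjI proper_equivI) (auto simp: abc)
  next
    case 3
    then show ?thesis
      by (intro exI[of _ "bqf_subst 1 0 1 1 f"] conjI proper_equivI) (auto simp: abc)
  qed
qed

text \<open>
  Every class contains a form \<open>(a, b, c)\<close> with \<open>q\<close> not dividing \<open>a\<close>; then \<open>(a, qb, q\<^sup>2c)\<close> is primitive,
  and its class determines that of \<open>(a, b, c)\<close>.
\<close>

lemma class_number_mono_prime:
  fixes q :: int
  assumes "prime q"
  shows "class_number D \<le> class_number (q^2 * D)"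
proof -
  define rep where "rep Q = (SOME f. f \<in> Q \<and> \<not> q dvd fst f)" for Q :: "(int \<times> int \<times> int) set"
  define up :: "int \<times> int \<times> int \<Rightarrow> int \<times> int \<times> int" where "up = (\<lambda>(a, b, c). (a, q * b, q^2 * c))"
  have rep: "rep Q \<in> Q \<and> \<not> q dvd fst (rep Q)" if Q: "Q \<in> bqf_forms D // bqf_equiv D" for Q
  proof -
    obtain f where f: "f \<in> bqf_forms D" "Q = bqf_equiv D `` {f}" using Q by (auto elim: quotientE)
    obtain g where g: "proper_equiv f g" "\<not> q dvd fst g"
      using ex_coprime_leading_coeff f(1) assms by blast
    then have "g \<in> Q" using f proper_equiv_forms by (auto simp: bqf_equiv_iff)
    then show ?thesis unfolding rep_def using g by (intro someI_ex[of "\<lambda>f. f \<in> Q \<and> \<not> q dvd fst f"]) blast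
  qed
  have rep_form: "rep Q \<in> bqf_forms D" if "Q \<in> bqf_forms D // bqf_equiv D" for Q
    using rep[OF that] that by (auto elim!: quotientE simp: bqf_equiv_iff)
  \<comment> \<open>So \<open>up f\<close> is the restriction of f to the sublattice of index q
    where q divides the second coordinate.\<close>
  have up_bqf: "bqf (up f) x y = bqf f x (q * y)" for f x y
    by (cases f) (simp add: up_def power2_eq_square algebra_simps)
  have up: "up f \<in> bqf_forms (q^2 * D)" if f: "f \<in> bqf_forms D" "\<not> q dvd fst f" for f
  proof -
    obtain a b c where abc: "f = (a, b, c)" by (cases f)
    have "coprime a q" using f abc assms by (metis coprime_commute fst_conv prime_imp_coprime)
    let ?n = "bqf_content (up f)"
    have n: "?n dvd a" "?n dvd q * b" "?n dvd q^2 * c"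
      by (auto simp: abc up_def bqf_content_def intro: dvd_trans)
    have "coprime ?n q" using \<open>coprime a q\<close> n(1) coprime_divisors[of ?n a q q] by simp
    then have "?n dvd b" "?n dvd c" using n(2,3) by (simp_all add: coprime_dvd_mult_right_iff)
    then have "?n dvd bqf_content f" using n(1) by (simp add: bqf_content_def abc)
    then have "?n dvd 1" using f by (simp add: bqf_forms_iff)
    then have "bqf_content (up f) = 1" using bqf_content_nonneg[of "up f"] by simp
    moreover have "bqf_disc (up f) = q^2 * D"
    proof -
      have "bqf_disc (up f) = q^2 * bqf_disc f"
        by (simp add: abc up_def bqf_disc_def power2_eq_square algebra_simps)
      then show ?thesis using f by (simp add: bqf_forms_iff bqf_posdef_forms_def)
    qed
    moreover have "bqf_posdef (up f)"
      using f assms by (auto simp: bqf_forms_iff bqf_posdef_forms_def bqf_posdef_def up_bqf)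
    ultimately show ?thesis by (simp add: bqf_forms_iff bqf_posdef_forms_def)
  qed
  have up_inj: "proper_equiv f g"
    if f: "\<not> q dvd fst f" and eq: "proper_equiv (up f) (up g)" for f g
  proof -
    obtain \<alpha> \<beta> \<gamma> \<delta> where det: "\<alpha> * \<delta> - \<beta> * \<gamma> = 1"
      and g: "\<And>x y. bqf (up g) x y = bqf (up f) (\<alpha> * x + \<beta> * y) (\<gamma> * x + \<delta> * y)"
      using eq unfolding proper_equiv_def by blast
    obtain a b c where abc: "f = (a, b, c)" by (cases f)
    \<comment> \<open>Modulo q the form \<open>up f\<close> is a x^2 with q not dividing a, while
      \<open>up g\<close> vanishes at (0,1); hence q divides \<beta>. The substitution then
      preserves the sublattice, and conjugating it by diag(1, q) gives an integral substitution from
      f to g.\<close>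
    have "q dvd bqf (up g) 0 1" by (cases g) (simp add: up_def)
    then have "q dvd a * \<beta>^2 + q * (b * \<beta> * \<delta> + q * c * \<delta>^2)"
      unfolding g by (simp add: abc up_def power2_eq_square algebra_simps)
    then have "q dvd a * \<beta>^2" by (metis dvd_add_left_iff dvd_triv_left)
    then have "q dvd \<beta>" using f assms abc by (simp add: prime_dvd_mult_iff prime_dvd_power_iff)
    then obtain \<beta>' where \<beta>': "\<beta> = q * \<beta>'" by blast
    have "bqf g x y = bqf f (\<alpha> * x + \<beta>' * y) (q * \<gamma> * x + \<delta> * y)" for x y
    proof -
      have "q^2 * bqf g x y = bqf g (q * x) (q * y)"
        by (cases g) (simp add: power2_eq_square algebra_simps)
      also have "\<dots> = bqf f (q * (\<alpha> * x + \<beta>' * y)) (q * (q * \<gamma> * x + \<delta> * y))"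
        using g[of "q * x" y] by (simp add: up_bqf \<beta>' algebra_simps)
      also have "\<dots> = q^2 * bqf f (\<alpha> * x + \<beta>' * y) (q * \<gamma> * x + \<delta> * y)"
        by (cases f) (simp add: power2_eq_square algebra_simps)
      finally show ?thesis using assms by (simp add: prime_gt_0_int)
    qed
    moreover have "\<alpha> * \<delta> - \<beta>' * (q * \<gamma>) = 1" using det by (simp add: \<beta>' algebra_simps)
    ultimately show ?thesis unfolding proper_equiv_def by blast
  qed
  show ?thesis unfolding class_number_def
  proof (rule card_inj_on_le[OF _ _ finite_classes])
    let ?h = "\<lambda>Q. bqf_equiv (q^2 * D) `` {up (rep Q)}"
    show "?h ` (bqf_forms D // bqf_equiv D) \<subseteq> bqf_forms (q^2 * D) // bqf_equiv (q^2 * D)"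
    proof
      fix Q' assume "Q' \<in> ?h ` (bqf_forms D // bqf_equiv D)"
      then obtain Q where Q: "Q \<in> bqf_forms D // bqf_equiv D" "Q' = ?h Q" by blast
      have "up (rep Q) \<in> bqf_forms (q^2 * D)" using up rep_form rep Q(1) by blast
      then show "Q' \<in> bqf_forms (q^2 * D) // bqf_equiv (q^2 * D)" unfolding Q(2) by (rule quotientI)
    qed
    show "inj_on ?h (bqf_forms D // bqf_equiv D)"
    proof (rule inj_onI)
      fix Q Q' assume Q: "Q \<in> bqf_forms D // bqf_equiv D" and Q': "Q' \<in> bqf_forms D // bqf_equiv D"
        and "?h Q = ?h Q'"
      then have "(up (rep Q), up (rep Q')) \<in> bqf_equiv (q^2 * D)"
        using eq_equiv_class[OF _ equiv_bqf_equiv] up rep rep_form by blast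
      then have "proper_equiv (rep Q) (rep Q')"
        using up_inj rep[OF Q] by (simp add: bqf_equiv_iff)
      then have "(rep Q, rep Q') \<in> bqf_equiv D" using rep_form Q Q' by (simp add: bqf_equiv_iff)
      then show "Q = Q'" using quotient_eqI[OF equiv_bqf_equiv Q Q'] rep Q Q' by blast
    qed
  qed
qed

section \<open>Representatives of all positive definite forms, primitive or not\<close>

definition represents_classes :: "int \<Rightarrow> (int \<times> int \<times> int) set \<Rightarrow> bool" where
  "represents_classes D R \<longleftrightarrow> (\<forall>f\<in>bqf_posdef_forms D. \<exists>r\<in>R. proper_equiv f r)"

lemma ex_primitive_class_representatives:
  "\<exists>R. finite R \<and> card R \<le> class_number D \<and> (\<forall>f\<in>bqf_forms D. \<exists>r\<in>R. proper_equiv f r)"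
proof -
  let ?Q = "bqf_forms D // bqf_equiv D"
  let ?rep = "\<lambda>q. SOME f. f \<in> q"
  have "\<exists>r\<in>?rep ` ?Q. proper_equiv f r" if f: "f \<in> bqf_forms D" for f
  proof (rule bexI)
    let ?q = "bqf_equiv D `` {f}"
    have "f \<in> ?q" using f by (simp add: bqf_equiv_iff proper_equiv_refl)
    then have "?rep ?q \<in> ?q" by (rule someI)
    then have "(f, ?rep ?q) \<in> bqf_equiv D" by blast
    then show "proper_equiv f (?rep ?q)" by (rule bqf_equiv_iff[THEN iffD1, THEN conjunct2, THEN conjunct2])
    show "?rep ?q \<in> ?rep ` ?Q" using f by (intro imageI quotientI)
  qed
  moreover have "card (?rep ` ?Q) \<le> class_number D"
    unfolding class_number_def using finite_classes by (rule card_image_le)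
  ultimately show ?thesis using finite_classes by blast
qed

text \<open>A form of content \<open>c\<close> is \<open>c\<close> times a primitive form of discriminant \<open>D / c\<^sup>2\<close>.\<close>

lemma represents_classes_by_content:
  assumes "finite C" "\<And>f. f \<in> bqf_posdef_forms D \<Longrightarrow> bqf_content f \<in> C"
    and "\<And>c. c \<in> C \<Longrightarrow> c \<noteq> 0 \<and> D = c^2 * D' c \<and> class_number (D' c) \<le> h"
  shows "\<exists>R. finite R \<and> card R \<le> card C * h \<and> represents_classes D R"
proof -
  define mul :: "int \<Rightarrow> int \<times> int \<times> int \<Rightarrow> int \<times> int \<times> int"
    where "mul n = (\<lambda>(a, b, c). (n * a, n * b, n * c))" for n
  have mul_bqf: "bqf (mul n f) x y = n * bqf f x y" for n f x y
    by (cases f) (simp add: mul_def algebra_simps)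
  obtain R where R: "\<And>c. c \<in> C \<Longrightarrow> finite (R c) \<and> card (R c) \<le> class_number (D' c) \<and>
      (\<forall>f\<in>bqf_forms (D' c). \<exists>r\<in>R c. proper_equiv f r)"
    using choice[of "\<lambda>c R. finite R \<and> card R \<le> class_number (D' c) \<and>
      (\<forall>f\<in>bqf_forms (D' c). \<exists>r\<in>R. proper_equiv f r)"] ex_primitive_class_representatives by blast
  let ?R = "\<Union>c\<in>C. mul c ` R c"
  have "finite ?R" using assms(1) R by blast
  moreover have "card ?R \<le> card C * h"
  proof -
    have "card ?R \<le> (\<Sum>c\<in>C. card (mul c ` R c))" by (rule card_UN_le[OF assms(1)])
    also have "\<dots> \<le> (\<Sum>c\<in>C. h)"
      using R assms(3) by (intro sum_mono) (meson card_image_le order_trans)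
    finally show ?thesis by simp
  qed
  moreover have "represents_classes D ?R"
    unfolding represents_classes_def
  proof
    fix f assume f: "f \<in> bqf_posdef_forms D"
    define n where "n = bqf_content f"
    have n: "n \<in> C" using assms(2) f n_def by blast
    then have n0: "n > 0" using assms(3) bqf_content_nonneg[of f] by (simp add: n_def less_le)
    obtain a b c where abc: "f = (a, b, c)" by (cases f)
    define g where "g = (a div n, b div n, c div n)"
    have dvd: "n dvd a" "n dvd b" "n dvd c" by (auto simp: n_def abc bqf_content_def intro: dvd_trans)
    then have fg: "f = mul n g" by (simp add: mul_def g_def abc)
    \<comment> \<open>Values of f are n times values of g, so n times the content of g divides the
      content n of f.\<close>
    have "n * bqf_content g dvd bqf_content f"
      unfolding dvd_bqf_content_iff[of _ f]
    proof (intro allI)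
      fix x y
      have "bqf_content g dvd bqf g x y" using dvd_bqf_content_iff[of "bqf_content g" g] by simp
      then show "n * bqf_content g dvd bqf f x y" unfolding fg mul_bqf by (rule mult_dvd_mono[OF dvd_refl])
    qed
    then have "n * bqf_content g dvd n * 1" by (simp only: n_def[symmetric] mult_1_right)
    then have "bqf_content g = 1" using n0 bqf_content_nonneg[of g] by simp
    have "bqf_disc f = n^2 * bqf_disc g"
      unfolding fg by (cases g) (simp add: mul_def bqf_disc_def power2_eq_square algebra_simps)
    moreover have "bqf_disc f = D" using f by (simp add: bqf_posdef_forms_def)
    moreover have "D = n^2 * D' n" using assms(3)[OF n] by blast
    ultimately have "n^2 * bqf_disc g = n^2 * D' n" by metis
    then have "bqf_disc g = D' n" using n0 by simp
    have "bqf_posdef g"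
      unfolding bqf_posdef_def
    proof (intro allI impI)
      fix x y :: int assume "(x, y) \<noteq> (0, 0)"
      then have "bqf f x y > 0" using f unfolding bqf_posdef_forms_def bqf_posdef_def by blast
      then show "bqf g x y > 0" unfolding fg mul_bqf using n0 by (simp add: zero_less_mult_iff)
    qed
    have "g \<in> bqf_forms (D' n)" using \<open>bqf_content g = 1\<close> \<open>bqf_disc g = D' n\<close> \<open>bqf_posdef g\<close> by (simp add: bqf_forms_iff bqf_posdef_forms_def)
    then obtain r where r: "r \<in> R n" "proper_equiv g r" using R[OF n] by blast
    have "proper_equiv f (mul n r)"
    proof -
      obtain \<alpha> \<beta> \<gamma> \<delta> where "\<alpha> * \<delta> - \<beta> * \<gamma> = 1"
        "\<And>x y. bqf r x y = bqf g (\<alpha> * x + \<beta> * y) (\<gamma> * x + \<delta> * y)"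
        using r(2) unfolding proper_equiv_def by blast
      then show ?thesis unfolding proper_equiv_def fg mul_bqf by auto
    qed
    then show "\<exists>r\<in>?R. proper_equiv f r" using r n by blast
  qed
  ultimately show ?thesis by (intro exI[of _ ?R] conjI)
qed

lemma bqf_content_square_dvd:
  assumes "f \<in> bqf_posdef_forms D"
  shows "(bqf_content f)^2 dvd D"
proof -
  obtain a b c where abc: "f = (a, b, c)" by (cases f)
  let ?n = "bqf_content f"
  have dvd: "?n dvd a" "?n dvd b" "?n dvd c" by (auto simp: abc bqf_content_def intro: dvd_trans)
  then have "?n^2 dvd b^2" "?n^2 dvd a * c"
    by (simp_all add: power2_eq_square mult_dvd_mono)
  then have "?n^2 dvd b^2 - 4 * (a * c)" using dvd_diff dvd_mult by blast
  then show ?thesis using assms by (simp add: bqf_posdef_forms_def bqf_disc_def abc mult.assoc)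
qed

text \<open>Either q divides n and q^2 cancels, or n^2 is prime to q^2 and divides m. With m = 12 or
  m = 3 this lists the possible contents.\<close>

lemma prime_square_dvd_imp:
  fixes q n :: int
  assumes "prime q" "n^2 dvd q^2 * m" "n \<ge> 0" "\<And>k. k^2 dvd m \<Longrightarrow> k \<ge> 0 \<Longrightarrow> k \<in> K"
  shows "n \<in> K \<union> (\<lambda>k. q * k) ` K"
proof (cases "q dvd n")
  case True
  then obtain k where k: "n = q * k" by blast
  then have "q^2 * k^2 dvd q^2 * m" using assms(2) by (simp add: power_mult_distrib)
  then have "k^2 dvd m" using prime_gt_0_int[OF assms(1)] by simp
  moreover have "k \<ge> 0" using assms(3) k prime_gt_0_int[OF assms(1)] by (simp add: zero_le_mult_iff)
  ultimately show ?thesis using assms(4) k by blast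
next
  case False
  then have "coprime n q" using assms(1) by (metis coprime_commute prime_imp_coprime)
  then have "coprime (n^2) (q^2)" by simp
  then have "n^2 dvd m" using assms(2) by (simp add: coprime_dvd_mult_right_iff)
  then show ?thesis using assms(3,4) by blast
qed

lemma square_dvd_3_or_12:
  fixes k :: int
  assumes "k^2 dvd m" "k \<ge> 0"
  shows "m = 3 \<Longrightarrow> k = 1" "m = 12 \<Longrightarrow> k \<in> {1, 2}"
proof -
  have *: "k^2 \<le> m" if "m > 0" using assms zdvd_imp_le that by blast
  have k: "k < 4" if "m \<le> 12" "m > 0"
  proof (rule ccontr)
    assume "\<not> k < 4"
    then have "4 * 4 \<le> k * k" by (intro mult_mono) auto
    then show False using * that by (simp add: power2_eq_square)
  qed
  have "k = 0 \<or> k = 1 \<or> k = 2 \<or> k = 3" if "m \<le> 12" "m > 0" using k that assms(2) by presburger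
  then show "m = 3 \<Longrightarrow> k = 1" "m = 12 \<Longrightarrow> k \<in> {1, 2}" using assms by auto
qed

text \<open>The factor 4 counts the contents 1, 2, p, 2p. The primitive parts have discriminants
  -12p^2, -3p^2, -12, -3, whose class numbers are all at most h(-12p^2), and a last factor 4 in the
  discriminant leads to -48p^2.\<close>

lemma ex_representatives_12_p_squared:
  fixes p :: nat
  assumes "prime p"
  shows "\<exists>R. finite R \<and> card R \<le> 4 * class_number (- 48 * (int p)^2) \<and>
    represents_classes (- 12 * (int p)^2) R"
proof -
  let ?p = "int p"
  have p: "prime ?p" "?p > 0" using assms by (simp_all add: prime_gt_0_nat)
  let ?C = "{1, 2} \<union> (\<lambda>k. ?p * k) ` {1, 2::int}"
  define D' where "D' c = - 12 * ?p^2 div c^2" for c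
  have le: "class_number (- 3) \<le> class_number (- 12)"
    "class_number (- 12) \<le> class_number (- 12 * ?p^2)"
    "class_number (- 3 * ?p^2) \<le> class_number (- 12 * ?p^2)"
    "class_number (- 12 * ?p^2) \<le> class_number (- 48 * ?p^2)"
    using class_number_mono_prime[of 2 "- 3"] class_number_mono_prime[of ?p "- 12"]
      class_number_mono_prime[of 2 "- 3 * ?p^2"] class_number_mono_prime[of 2 "- 12 * ?p^2"] p(1)
    by (simp_all add: mult.commute)
  have "\<exists>R. finite R \<and> card R \<le> card ?C * class_number (- 48 * ?p^2) \<and>
      represents_classes (- 12 * ?p^2) R"
  proof (rule represents_classes_by_content)
    fix f assume "f \<in> bqf_posdef_forms (- 12 * ?p^2)"
    then have "(bqf_content f)^2 dvd - 12 * ?p^2" by (rule bqf_content_square_dvd)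
    then have "(bqf_content f)^2 dvd ?p^2 * 12" by (simp add: mult.commute)
    then show "bqf_content f \<in> ?C"
      using prime_square_dvd_imp[OF p(1) _ bqf_content_nonneg, of f 12 "{1, 2}"]
        square_dvd_3_or_12(2)[of _ 12] by blast
  next
    fix c assume "c \<in> ?C"
    then consider "c = 1" | "c = 2" | "c = ?p" | "c = ?p * 2" by auto
    then show "c \<noteq> 0 \<and> - 12 * ?p^2 = c^2 * D' c \<and> class_number (D' c) \<le> class_number (- 48 * ?p^2)"
    proof cases
      case 1 then show ?thesis using le by (simp add: D'_def)
    next
      case 2
      then have "D' c = - 3 * ?p^2" by (simp add: D'_def)
      then show ?thesis using le 2 by simp
    next
      case 3
      then have "D' c = - 12" using nonzero_mult_div_cancel_right[of "?p^2" "- 12"] p(2) by (simp add: D'_def)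
      then show ?thesis using le p(2) 3 by simp
    next
      case 4
      have c2: "c^2 = 4 * ?p^2" by (simp add: 4 power_mult_distrib)
      have "D' c = (- 3) * c^2 div c^2" by (simp add: D'_def c2)
      then have "D' c = - 3" using 4 p(2) by (subst (asm) nonzero_mult_div_cancel_right) auto
      then show ?thesis using order_trans[OF le(1) order_trans[OF le(2,4)]] p(2) 4 by (simp add: c2)
    qed
  qed simp
  then obtain R where R: "finite R" "card R \<le> card ?C * class_number (- 48 * ?p^2)"
    "represents_classes (- 12 * ?p^2) R" by blast
  have "card ?C \<le> 4" by (simp add: card_insert_if)
  then have "card R \<le> 4 * class_number (- 48 * ?p^2)" 
    by (rule order_trans[OF R(2) mult_le_mono1])
  then show ?thesis using R by blast
qed

text \<open>Here the contents are 1 and p, with primitive parts of discriminant -3p^2 and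
  -3.\<close>

lemma ex_representatives_3_p_squared:
  fixes p :: nat
  assumes "prime p"
  shows "\<exists>R. finite R \<and> card R \<le> 2 * class_number (- 12 * (int p)^2) \<and>
    represents_classes (- 3 * (int p)^2) R"
proof -
  let ?p = "int p"
  have p: "prime ?p" "?p > 0" using assms by (simp_all add: prime_gt_0_nat)
  let ?C = "{1} \<union> (\<lambda>k. ?p * k) ` {1::int}"
  define D' where "D' c = - 3 * ?p^2 div c^2" for c
  have le: "class_number (- 3) \<le> class_number (- 3 * ?p^2)"
    "class_number (- 3 * ?p^2) \<le> class_number (- 12 * ?p^2)"
    using class_number_mono_prime[of ?p "- 3"] class_number_mono_prime[of 2 "- 3 * ?p^2"] p(1)
    by (simp_all add: mult.commute)
  have "\<exists>R. finite R \<and> card R \<le> card ?C * class_number (- 12 * ?p^2) \<and>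
      represents_classes (- 3 * ?p^2) R"
  proof (rule represents_classes_by_content)
    fix f assume "f \<in> bqf_posdef_forms (- 3 * ?p^2)"
    then have "(bqf_content f)^2 dvd - 3 * ?p^2" by (rule bqf_content_square_dvd)
    then have "(bqf_content f)^2 dvd ?p^2 * 3" by (simp add: mult.commute)
    then show "bqf_content f \<in> ?C"
      using prime_square_dvd_imp[OF p(1) _ bqf_content_nonneg, of f 3 "{1}"]
        square_dvd_3_or_12(1)[of _ 3] by blast
  next
    fix c assume "c \<in> ?C"
    then consider "c = 1" | "c = ?p" by auto
    then show "c \<noteq> 0 \<and> - 3 * ?p^2 = c^2 * D' c \<and> class_number (D' c) \<le> class_number (- 12 * ?p^2)"
    proof cases
      case 1 then show ?thesis using le by (simp add: D'_def)
    next
      case 2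
      then have "D' c = - 3" using nonzero_mult_div_cancel_right[of "?p^2" "- 3"] p(2) by (simp add: D'_def)
      then show ?thesis using le p(2) 2 by simp
    qed
  qed simp
  then obtain R where R: "finite R" "card R \<le> card ?C * class_number (- 12 * ?p^2)"
    "represents_classes (- 3 * ?p^2) R" by blast
  have "card ?C \<le> 2" by (simp add: card_insert_if)
  then have "card R \<le> 2 * class_number (- 12 * ?p^2)" 
    by (rule order_trans[OF R(2) mult_le_mono1])
  then show ?thesis using R by blast
qed

lemma represents_classes_reduced:
  assumes "\<And>f. f \<in> bqf_posdef_forms D \<Longrightarrow> bqf_reduced f \<Longrightarrow> f \<in> R"
  shows "represents_classes D R"
  unfolding represents_classes_def
proof
  fix f assume f: "f \<in> bqf_posdef_forms D"
  then have "bqf_posdef f" by (simp add: bqf_posdef_forms_def)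
  then obtain g where "proper_equiv f g" "bqf_reduced g" using ex_reduced by blast
  then show "\<exists>r\<in>R. proper_equiv f r" using assms proper_equiv_posdef_forms f by blast
qed

text \<open>From 3a^2 \<le> 12 the leading coefficient is 1 or 2. \<open>bqf_reduced\<close> has no
  sign convention in boundary cases, so the equivalent forms (2, 2, 2) and (2, -2, 2) both appear;
  three forms are still few enough for the bound 8p.\<close>

lemma represents_classes_12: "represents_classes (- 12) {(1, 0, 3), (2, 2, 2), (2, -2, 2)}"
proof (rule represents_classes_reduced)
  fix f :: "int \<times> int \<times> int"
  assume f: "f \<in> bqf_posdef_forms (- 12)" "bqf_reduced f"
  obtain a b c where abc: "f = (a, b, c)" by (cases f)
  have r: "0 < a" "3 * a^2 \<le> 12" "\<bar>b\<bar> \<le> a" "4 * a * c = b^2 + 12"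
    using reduced_bounds[of a b c "- 12"] f by (auto simp: abc)
  have "a < 3"
  proof (rule ccontr)
    assume "\<not> a < 3"
    then have "3 * 3 \<le> a * a" by (intro mult_mono) auto
    then show False using r(2) by (simp add: power2_eq_square)
  qed
  then have a: "a = 1 \<or> a = 2" using r(1) by presburger
  then have "b = -2 \<or> b = -1 \<or> b = 0 \<or> b = 1 \<or> b = 2" using r(3) by presburger
  with a show "f \<in> {(1, 0, 3), (2, 2, 2), (2, -2, 2)}" using r(3,4) by (auto simp: abc) presburger+
qed

lemma represents_classes_3: "represents_classes (- 3) {(1, 1, 1), (1, -1, 1)}"
proof (rule represents_classes_reduced)
  fix f :: "int \<times> int \<times> int"
  assume f: "f \<in> bqf_posdef_forms (- 3)" "bqf_reduced f"
  obtain a b c where abc: "f = (a, b, c)" by (cases f)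
  have r: "0 < a" "3 * a^2 \<le> 3" "\<bar>b\<bar> \<le> a" "4 * a * c = b^2 + 3"
    using reduced_bounds[of a b c "- 3"] f by (auto simp: abc)
  have "a < 2"
  proof (rule ccontr)
    assume "\<not> a < 2"
    then have "2 * 2 \<le> a * a" by (intro mult_mono) auto
    then show False using r(2) by (simp add: power2_eq_square)
  qed
  then have a: "a = 1" using r(1) by presburger
  then have "b = -1 \<or> b = 0 \<or> b = 1" using r(3) by presburger
  with a show "f \<in> {(1, 1, 1), (1, -1, 1)}" using r(4) by (auto simp: abc) presburger+
qed

section \<open>The quadratic space\<close>

lemma exhaust_6:
  fixes x :: 6
  shows "x = 1 \<or> x = 2 \<or> x = 3 \<or> x = 4 \<or> x = 5 \<or> x = 6"
proof (induct x)
  case (of_int z)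
  then have "0 \<le> z" "z < 6" by simp_all
  then have "z = 0 \<or> z = 1 \<or> z = 2 \<or> z = 3 \<or> z = 4 \<or> z = 5" by presburger
  then show ?case by auto
qed

lemma forall_6: "(\<forall>i::6. P i) \<longleftrightarrow> P 1 \<and> P 2 \<and> P 3 \<and> P 4 \<and> P 5 \<and> P 6"
  by (metis exhaust_6)

lemma UNIV_6: "UNIV = {1, 2, 3, 4, 5, 6::6}"
  using exhaust_6 by auto

lemma sum_6: "sum f (UNIV::6 set) = f 1 + f 2 + f 3 + f 4 + f 5 + f 6"
  unfolding UNIV_6 by (simp add: ac_simps)

lemma form_commute: "form d x y = form d y x"
  by (simp add: form_def algebra_simps)

lemma form_add_left: "form d (x + y) z = form d x z + form d y z"
  and form_add_right: "form d z (x + y) = form d z x + form d z y"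
  and form_diff_left: "form d (x - y) z = form d x z - form d y z"
  and form_diff_right: "form d z (x - y) = form d z x - form d z y"
  by (simp_all add: form_def algebra_simps)

lemma form_minus_left: "form d (- x) z = - form d x z"
  and form_minus_right: "form d z (- x) = - form d z x"
  by (simp_all add: form_def algebra_simps)

lemma form_zero: "form d 0 z = 0" "form d z 0 = 0"
  by (simp_all add: form_def)

lemma form_scale_left: "form d (c *\<^sub>R x) z = c * form d x z"
  and form_scale_right: "form d z (c *\<^sub>R x) = c * form d z x"
  for x z :: "real ^ 6"
  by (simp_all add: form_def algebra_simps)

lemmas form_linear = form_add_left form_add_right form_diff_left form_diff_right
  form_minus_left form_minus_right form_scale_left form_scale_right form_zero

lemma form_axis:
  fixes x :: "real ^ 6"
  shows "form d x (axis 1 1) = x$2" "form d x (axis 2 1) = x$1"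
    "form d x (axis 3 1) = x$4" "form d x (axis 4 1) = x$3"
    "form d x (axis 5 1) = - 2 * real d * x$5" "form d x (axis 6 1) = - 6 * x$6"
  by (simp_all add: form_def axis_def)

lemma form_nondegenerate:
  fixes x :: "real ^ 6"
  assumes "d > 0" "\<And>y. form d x y = 0"
  shows "x = 0"
  using assms(2)[of "axis 1 1"] assms(2)[of "axis 2 1"] assms(2)[of "axis 3 1"]
    assms(2)[of "axis 4 1"] assms(2)[of "axis 5 1"] assms(2)[of "axis 6 1"] assms(1)
  by (simp add: form_axis vec_eq_iff forall_6)

text \<open>With integer scalars, sublattices are subspaces and \<open>Z.span\<close> is the
  subgroup generated by a set.\<close>

interpretation Z: module "\<lambda>(n::int) (x::real ^ 6). of_int n *\<^sub>R x"
  by unfold_locales (simp_all add: algebra_simps)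

lemma Ints_lat: "x \<in> lat \<Longrightarrow> x $ i \<in> \<int>"
  by (simp add: lat_def)

lemma subspace_lat: "Z.subspace lat"
  by (rule Z.subspaceI) (simp_all add: lat_def)

lemma axis_in_lat: "axis i 1 \<in> lat"
  by (simp add: lat_def axis_def)

lemma span_range_eq:
  fixes v :: "'i::finite \<Rightarrow> real ^ 6"
  shows "Z.span (range v) = range (\<lambda>c. \<Sum>i\<in>UNIV. of_int (c i) *\<^sub>R v i)"
proof
  let ?S = "range (\<lambda>c. \<Sum>i\<in>UNIV. of_int (c i) *\<^sub>R v i)"
  have "Z.subspace ?S"
  proof (rule Z.subspaceI)
    show "0 \<in> ?S" by (rule image_eqI[of _ _ "\<lambda>_. 0"]) auto
  next
    fix x y assume "x \<in> ?S" "y \<in> ?S"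
    then obtain b c where "x = (\<Sum>i\<in>UNIV. of_int (b i) *\<^sub>R v i)" "y = (\<Sum>i\<in>UNIV. of_int (c i) *\<^sub>R v i)"
      by blast
    then show "x + y \<in> ?S"
      by (intro image_eqI[of _ _ "\<lambda>i. b i + c i"]) (auto simp: sum.distrib algebra_simps)
  next
    fix n x assume "x \<in> ?S"
    then obtain b where "x = (\<Sum>i\<in>UNIV. of_int (b i) *\<^sub>R v i)" by blast
    then show "of_int n *\<^sub>R x \<in> ?S"
      by (intro image_eqI[of _ _ "\<lambda>i. n * b i"]) (auto simp: scaleR_sum_right)
  qed
  moreover have "v i \<in> ?S" for i
  proof (rule image_eqI[of _ _ "\<lambda>j. if j = i then 1 else 0"])
    show "v i = (\<Sum>j\<in>UNIV. of_int (if j = i then 1 else 0) *\<^sub>R v j)"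
      by (subst sum.remove[of _ i]) auto
  qed simp
  ultimately show "Z.span (range v) \<subseteq> ?S" by (intro Z.span_minimal) auto
  show "?S \<subseteq> Z.span (range v)"
    by clarify (rule Z.span_sum, rule Z.span_scale, rule Z.span_base, simp)
qed

lemma span_image_eq:
  assumes "finite I"
  shows "Z.span (v ` I) = range (\<lambda>c. \<Sum>i\<in>I. of_int (c i) *\<^sub>R v i)"
  using assms
proof (induction I rule: finite_induct)
  case empty
  then show ?case by auto
next
  case (insert i I)
  show ?case
  proof (intro equalityI subsetI)
    fix x assume "x \<in> Z.span (v ` insert i I)"
    then obtain k where "x - of_int k *\<^sub>R v i \<in> Z.span (v ` I)"
      unfolding image_insert Z.span_insert by blast
    then obtain c where "x - of_int k *\<^sub>R v i = (\<Sum>i\<in>I. of_int (c i) *\<^sub>R v i)"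
      unfolding insert.IH by blast
    then have x: "x = of_int k *\<^sub>R v i + (\<Sum>i\<in>I. of_int (c i) *\<^sub>R v i)" by (simp add: algebra_simps)
    have "(\<Sum>j\<in>I. of_int ((c(i := k)) j) *\<^sub>R v j) = (\<Sum>i\<in>I. of_int (c i) *\<^sub>R v i)"
      using insert.hyps by (intro sum.cong) auto
    then show "x \<in> range (\<lambda>c. \<Sum>i\<in>insert i I. of_int (c i) *\<^sub>R v i)"
      using insert.hyps by (intro image_eqI[of _ _ "c(i := k)"]) (auto simp: x)
  next
    fix x assume "x \<in> range (\<lambda>c. \<Sum>i\<in>insert i I. of_int (c i) *\<^sub>R v i)"
    then obtain c where "x = (\<Sum>j\<in>insert i I. of_int (c j) *\<^sub>R v j)" by blast
    then show "x \<in> Z.span (v ` insert i I)"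
      by (simp only:) (intro Z.span_sum Z.span_scale Z.span_base imageI)
  qed
qed

lemma form_lat_Ints:
  assumes "x \<in> lat" "y \<in> lat"
  shows "form d x y \<in> \<int>"
  unfolding form_def using assms by (intro Ints_add Ints_diff Ints_mult) (auto intro: Ints_lat)

lemma form_lat_even:
  assumes "x \<in> lat"
  shows "\<exists>n. form d x x = 2 * of_int n"
proof -
  have "x$1 * x$2 + x$3 * x$4 - of_nat d * x$5 * x$5 - 3 * x$6 * x$6 \<in> \<int>"
    using assms by (intro Ints_add Ints_diff Ints_mult) (auto intro: Ints_lat)
  then obtain n where "x$1 * x$2 + x$3 * x$4 - of_nat d * x$5 * x$5 - 3 * x$6 * x$6 = of_int n"
    by (auto simp: Ints_def)
  then have "form d x x = 2 * of_int n" by (simp add: form_def algebra_simps)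
  then show ?thesis by blast
qed

text \<open>The elementary operation on generators from which the later changes of a single basis
  vector are built.\<close>

lemma span_insert_cong:
  assumes "x' - x \<in> Z.span S"
  shows "Z.span (insert x' S) = Z.span (insert x S)"
proof -
  have "Z.span (insert x' S) \<subseteq> Z.span (insert x S)" if "x' - x \<in> Z.span S" for x x'
  proof -
    have "x' - x + x \<in> Z.span (insert x S)"
      using that Z.span_mono[of S "insert x S"] Z.span_base[of x "insert x S"] by (intro Z.span_add) auto
    then have "x' \<in> Z.span (insert x S)" by simp
    then show ?thesis using Z.span_superset[of "insert x S"] by (intro Z.span_minimal) auto
  qed
  moreover have "x - x' \<in> Z.span S" using Z.span_neg[OF assms] by simp
  ultimately show ?thesis using assms by blast
qed

section \<open>Determinants of Gram matrices\<close>

text \<open>Indexing by the type \<open>6\<close> lets \<open>vec_lambda\<close> turn six vectors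
  into the rows of a matrix.\<close>

definition hexad :: "'a \<Rightarrow> 'a \<Rightarrow> 'a \<Rightarrow> 'a \<Rightarrow> 'a \<Rightarrow> 'a \<Rightarrow> 6 \<Rightarrow> 'a" where
  "hexad a b c d e f = (\<lambda>i. if i = 1 then a else if i = 2 then b else if i = 3 then c
     else if i = 4 then d else if i = 5 then e else f)"

lemma hexad_simps [simp]:
  "hexad a b c d e f 1 = a" "hexad a b c d e f 2 = b" "hexad a b c d e f 3 = c"
  "hexad a b c d e f 4 = d" "hexad a b c d e f 5 = e" "hexad a b c d e f 6 = f"
  by (simp_all add: hexad_def)

lemma range_hexad: "range (hexad a b c d e f) = {a, b, c, d, e, f}"
  unfolding UNIV_6 by simp

lemma hexad_upd:
  "(hexad a b c d e f)(1 := x) = hexad x b c d e f"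
  "(hexad a b c d e f)(2 := x) = hexad a x c d e f"
  "(hexad a b c d e f)(3 := x) = hexad a b x d e f"
  "(hexad a b c d e f)(4 := x) = hexad a b c x e f"
  "(hexad a b c d e f)(5 := x) = hexad a b c d x f"
  "(hexad a b c d e f)(6 := x) = hexad a b c d e x"
  by (simp_all add: fun_eq_iff forall_6)

lemma det_rows_add:
  fixes r :: "6 \<Rightarrow> real ^ 6"
  assumes "i \<noteq> j"
  shows "det (vec_lambda (r(i := r i + c *\<^sub>R r j))) = det (vec_lambda r)"
proof -
  have "vec_lambda (r(i := r i + c *\<^sub>R r j)) = (\<chi> k. if k = i then row i (vec_lambda r)
      + c *s row j (vec_lambda r) else row k (vec_lambda r))"
    by (simp add: vec_eq_iff row_def scalar_mult_eq_scaleR)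
  then show ?thesis using det_row_operation[OF assms, of "vec_lambda r" c] by simp
qed

lemma det_rows_scale:
  fixes r :: "6 \<Rightarrow> real ^ 6"
  shows "det (vec_lambda (r(i := c *\<^sub>R r i))) = c * det (vec_lambda r)"
proof -
  have "vec_lambda (r(i := c *\<^sub>R r i)) = (\<chi> k. if k = i then c *s r k else r k)"
    by (simp add: vec_eq_iff scalar_mult_eq_scaleR)
  moreover have "vec_lambda r = (\<chi> k. if k = i then r k else r k)" by simp
  ultimately show ?thesis using det_row_mul[of i c r r] by simp
qed

definition det6 :: "real ^ 6 \<Rightarrow> real ^ 6 \<Rightarrow> real ^ 6 \<Rightarrow> real ^ 6 \<Rightarrow> real ^ 6 \<Rightarrow> real ^ 6 \<Rightarrow> real" where
  "det6 a b c d e f = det (vec_lambda (hexad a b c d e f))"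

lemma det6_add:
  "det6 (a + k *\<^sub>R b) b c d e f = det6 a b c d e f"
  "det6 a (b + k *\<^sub>R a) c d e f = det6 a b c d e f"
  "det6 a (b + k *\<^sub>R c) c d e f = det6 a b c d e f"
  "det6 a b (c + k *\<^sub>R d) d e f = det6 a b c d e f"
  "det6 a b c (d + k *\<^sub>R c) e f = det6 a b c d e f"
  "det6 a b c d (e + k *\<^sub>R a) f = det6 a b c d e f"
  "det6 a b c d (e + k *\<^sub>R c) f = det6 a b c d e f"
  "det6 a b c d e (f + k *\<^sub>R a) = det6 a b c d e f"
  "det6 a b c d e (f + k *\<^sub>R c) = det6 a b c d e f"
  "det6 a b c d e (f + k *\<^sub>R e) = det6 a b c d e f"
  unfolding det6_def
  using det_rows_add[of 1 2 "hexad a b c d e f" k] det_rows_add[of 2 1 "hexad a b c d e f" k]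
    det_rows_add[of 2 3 "hexad a b c d e f" k]
    det_rows_add[of 3 4 "hexad a b c d e f" k] det_rows_add[of 4 3 "hexad a b c d e f" k]
    det_rows_add[of 5 1 "hexad a b c d e f" k] det_rows_add[of 5 3 "hexad a b c d e f" k]
    det_rows_add[of 6 1 "hexad a b c d e f" k] det_rows_add[of 6 3 "hexad a b c d e f" k]
    det_rows_add[of 6 5 "hexad a b c d e f" k]
  by (simp_all add: hexad_upd)

lemma det6_scale:
  "det6 a (k *\<^sub>R b) c d e f = k * det6 a b c d e f"
  "det6 a b c (k *\<^sub>R d) e f = k * det6 a b c d e f"
  unfolding det6_def
  using det_rows_scale[of "hexad a b c d e f" 2 k] det_rows_scale[of "hexad a b c d e f" 4 k]
  by (simp_all add: hexad_upd)

text \<open>Used to pass from a hyperbolic pair u, v to the orthogonal pair u + v, u - v. Two pairs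
  give the factor 4, which becomes 16 in the Gram determinant.\<close>

lemma det6_sum_difference:
  "det6 (a + b) (a - b) c d e f = - 2 * det6 a b c d e f"
  "det6 a b (c + d) (c - d) e f = - 2 * det6 a b c d e f"
proof -
  have eq: "u - v = (- 2) *\<^sub>R v + 1 *\<^sub>R (u + v)" for u v :: "real ^ 6"
    by (simp add: scaleR_2)
  show "det6 (a + b) (a - b) c d e f = - 2 * det6 a b c d e f"
    unfolding eq[of a b] det6_add(2) det6_scale using det6_add(1)[of a 1 b c d e f] by simp
  show "det6 a b (c + d) (c - d) e f = - 2 * det6 a b c d e f"
    unfolding eq[of c d] det6_add(5) det6_scale using det6_add(4)[of a b c 1 d e f] by simp
qed

definition form_matrix :: "nat \<Rightarrow> real ^ 6 ^ 6" where
  "form_matrix d = (\<chi> i j. form d (axis i 1) (axis j 1))"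

lemma form_expand:
  fixes x y :: "real ^ 6"
  shows "form d x y = (\<Sum>j\<in>UNIV. (\<Sum>i\<in>UNIV. x$i * form_matrix d $ i $ j) * y$j)"
  by (simp add: sum_6 form_matrix_def form_axis) (simp add: form_def axis_def algebra_simps)

lemma det_gram:
  fixes r :: "6 \<Rightarrow> real ^ 6"
  shows "det (\<chi> i j. form d (r i) (r j)) = (det (vec_lambda r))^2 * det (form_matrix d)"
proof -
  have "(\<chi> i j. form d (r i) (r j)) = vec_lambda r ** form_matrix d ** transpose (vec_lambda r)"
    by (simp add: vec_eq_iff matrix_matrix_mult_def transpose_def form_expand)
  then show ?thesis by (simp add: det_mul power2_eq_square)
qed

text \<open>
  Adding multiples of \<open>e\<^sub>1\<close> and \<open>e\<^sub>2\<close> to \<open>f\<^sub>1, f\<^sub>2, x, y\<close> splits the form into two hyperbolic planes,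
  scaled by \<open>a\<close> and by 1, and the binary form of \<open>x, y\<close>.
\<close>

lemma det_gram_isotropic_flag:
  fixes e1 e2 x y f1 f2 :: "real ^ 6"
  assumes "a \<noteq> 0" "form d x x \<noteq> 0"
    and "form d e1 e1 = 0" "form d e1 e2 = 0" "form d e2 e2 = 0"
    and "form d e1 x = 0" "form d e1 y = 0" "form d e2 x = 0" "form d e2 y = 0"
    and "form d e1 f1 = 0" "form d e1 f2 = a" "form d e2 f1 = 1" "form d e2 f2 = 0"
  shows "a^2 * (form d x x * form d y y - (form d x y)^2)
    = (det6 e1 f2 e2 f1 x y)^2 * det (form_matrix d)"
proof -
  define f1' where "f1' = f1 + (- form d f1 f1 / 2) *\<^sub>R e2"
  define f2' where "f2' = f2 + (- form d f2 f2 / (2 * a)) *\<^sub>R e1 + (- form d f1 f2) *\<^sub>R e2"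
  define x' where "x' = x + (- form d x f2 / a) *\<^sub>R e1 + (- form d x f1) *\<^sub>R e2"
  define y' where "y' = y + (- form d y f2 / a) *\<^sub>R e1 + (- form d y f1) *\<^sub>R e2"
  \<comment> \<open>A Gram-Schmidt step, possible because \<open>form d x x\<close> is nonzero.
    Together with sums and differences of the hyperbolic pairs it gives an orthogonal system, so the
    Gram determinant is the product of the norms 2a, -2a, 2, -2 and the two of the binary
    part.\<close>
  define z where "z = y' + (- form d x y / form d x x) *\<^sub>R x'"
  define r where "r = hexad (e1 + f2') (e1 - f2') (e2 + f1') (e2 - f1') x' z"
  note sym = form_commute[of d f2 e1] form_commute[of d f2 e2] form_commute[of d f1 e1]
    form_commute[of d f1 e2] form_commute[of d x e1] form_commute[of d x e2]
    form_commute[of d y e1] form_commute[of d y e2] form_commute[of d e2 e1]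
    form_commute[of d f2 f1] form_commute[of d f2 x] form_commute[of d f1 x]
    form_commute[of d f2 y] form_commute[of d f1 y] form_commute[of d y x]
  have g1: "form d e1 f2' = a" "form d f2' e1 = a" "form d f2' f2' = 0" "form d f1' f1' = 0"
    "form d e2 f1' = 1" "form d f1' e2 = 1" "form d e1 f1' = 0" "form d f1' e1 = 0"
    "form d e2 f2' = 0" "form d f2' e2 = 0" "form d f1' f2' = 0" "form d f2' f1' = 0"
    unfolding f1'_def f2'_def by (simp_all add: form_linear assms sym field_simps)
  have g2: "form d e1 x' = 0" "form d x' e1 = 0" "form d e2 x' = 0" "form d x' e2 = 0"
    "form d f2' x' = 0" "form d x' f2' = 0" "form d f1' x' = 0" "form d x' f1' = 0"
    "form d e1 y' = 0" "form d y' e1 = 0" "form d e2 y' = 0" "form d y' e2 = 0"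
    "form d f2' y' = 0" "form d y' f2' = 0" "form d f1' y' = 0" "form d y' f1' = 0"
    "form d x' x' = form d x x" "form d x' y' = form d x y" "form d y' x' = form d x y"
    "form d y' y' = form d y y"
    unfolding f1'_def f2'_def x'_def y'_def
    by (simp_all add: form_linear assms sym field_simps)
  have "det6 (e1 + f2') (e1 - f2') (e2 + f1') (e2 - f1') x' z = 4 * det6 e1 f2' e2 f1' x' z"
    by (simp add: det6_sum_difference)
  also have "\<dots> = 4 * det6 e1 f2 e2 f1 x y"
    unfolding z_def f1'_def f2'_def x'_def y'_def by (simp only: det6_add)
  finally have r: "det (vec_lambda r) = 4 * det6 e1 f2 e2 f1 x y" unfolding r_def det6_def .
  have "det (\<chi> i j. form d (r i) (r j)) = (\<Prod>i\<in>UNIV. form d (r i) (r i))"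
  proof (subst det_diagonal)
    fix i j :: 6
    assume "i \<noteq> j"
    then show "(\<chi> i j. form d (r i) (r j)) $ i $ j = 0"
      using exhaust_6[of i] exhaust_6[of j] assms(2)
      by (elim disjE) (simp_all add: r_def z_def form_linear assms(3-5) sym(9) g1 g2)
  qed simp
  also have "\<dots> = 16 * a^2 * (form d x x * form d y y - (form d x y)^2)"
    using assms(2) unfolding UNIV_6
    by (simp add: r_def z_def form_linear assms(3-5) sym(9) g1 g2) (simp add: field_simps power2_eq_square)
  finally show ?thesis unfolding det_gram r by (simp add: power_mult_distrib)
qed

text \<open>The same formula read for the standard basis, where a = 1, the change of basis is
  trivial and the binary part is diag(-2d, -6).\<close>

lemma det_form_matrix: "d > 0 \<Longrightarrow> det (form_matrix d) = 12 * real d"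
proof -
  assume "d > 0"
  have "vec_lambda (hexad (axis 1 1) (axis 2 1) (axis 3 1) (axis 4 1) (axis 5 1) (axis 6 1))
      = (mat 1 :: real ^ 6 ^ 6)"
    by (simp add: vec_eq_iff forall_6 mat_def axis_def)
  then have "det6 (axis 1 1) (axis 2 1) (axis 3 1) (axis 4 1) (axis 5 1) (axis 6 1) = 1"
    by (simp add: det6_def)
  moreover have "1^2 * (form d (axis 5 1) (axis 5 1) * form d (axis 6 1) (axis 6 1)
      - (form d (axis 5 1) (axis 6 1))^2)
    = (det6 (axis 1 1) (axis 2 1) (axis 3 1) (axis 4 1) (axis 5 1) (axis 6 1 :: real ^ 6))^2 * det (form_matrix d)"
    using \<open>d > 0\<close> by (intro det_gram_isotropic_flag) (simp_all add: form_axis, simp_all add: axis_def)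
  ultimately show ?thesis by (simp add: form_axis) (simp add: axis_def)
qed

lemma det_Ints:
  fixes A :: "real ^ 'n ^ 'n"
  assumes "\<And>i j. A $ i $ j \<in> \<int>"
  shows "det A \<in> \<int>"
  unfolding det_def using assms by (intro Ints_sum Ints_mult Ints_prod) auto

text \<open>The basis and the matrix expressing the standard basis in it are both integral, and
  their determinants multiply to 1.\<close>

lemma det_lattice_basis:
  fixes r :: "6 \<Rightarrow> real ^ 6"
  assumes "Z.span (range r) = lat"
  shows "(det (vec_lambda r))^2 = 1"
proof -
  have "\<forall>j. \<exists>c. axis j 1 = (\<Sum>i\<in>UNIV. of_int (c i) *\<^sub>R r i)"
    using axis_in_lat unfolding assms[symmetric] span_range_eq by blast
  then obtain c where c: "\<And>j. axis j 1 = (\<Sum>i\<in>UNIV. of_int (c j i) *\<^sub>R r i)" by metis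
  define C where "C = (\<chi> j i. real_of_int (c j i))"
  have "C ** vec_lambda r = mat 1"
  proof -
    have "(C ** vec_lambda r) $ j = axis j 1" for j
      by (simp add: c vec_eq_iff matrix_matrix_mult_def C_def)
    then show ?thesis by (simp add: vec_eq_iff mat_def axis_def)
  qed
  then have *: "det C * det (vec_lambda r) = 1" by (metis det_I det_mul)
  have "det C \<in> \<int>" by (rule det_Ints) (simp add: C_def)
  then obtain m where m: "det C = of_int m" by (auto simp: Ints_def)
  have "r i \<in> lat" for i using assms Z.span_superset[of "range r"] by blast
  then have "det (vec_lambda r) \<in> \<int>" by (intro det_Ints) (simp add: Ints_lat)
  then obtain n where n: "det (vec_lambda r) = of_int n" by (auto simp: Ints_def)
  have "m * n = 1" using * unfolding m n by (metis of_int_1 of_int_eq_iff of_int_mult)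
  then have "n = 1 \<or> n = - 1" by (auto simp: zmult_eq_1_iff)
  then show ?thesis unfolding n by auto
qed

lemma transpose_rows_mult_vec:
  fixes r :: "6 \<Rightarrow> real ^ 6"
  shows "transpose (vec_lambda r) *v w = (\<Sum>i\<in>UNIV. w $ i *\<^sub>R r i)"
  by (simp add: vec_eq_iff matrix_vector_mult_def transpose_def mult.commute)

lemma invertible_transpose_lattice_basis:
  fixes r :: "6 \<Rightarrow> real ^ 6"
  assumes "Z.span (range r) = lat"
  shows "invertible (transpose (vec_lambda r))"
proof -
  have "det (vec_lambda r) \<noteq> 0" using det_lattice_basis[OF assms] by auto
  then show ?thesis by (simp add: invertible_det_nz)
qed

lemma lattice_basis_independent:
  fixes r :: "6 \<Rightarrow> real ^ 6"
  assumes "Z.span (range r) = lat" "(\<Sum>i\<in>UNIV. c i *\<^sub>R r i) = 0"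
  shows "c i = 0"
proof -
  have "transpose (vec_lambda r) *v vec_lambda c = (\<Sum>i\<in>UNIV. c i *\<^sub>R r i)"
    unfolding transpose_rows_mult_vec by simp
  then have "vec_lambda c = 0"
    using assms invertible_transpose_lattice_basis matrix_left_invertible_ker
    unfolding invertible_def by metis
  then show ?thesis by (metis vec_lambda_inverse UNIV_I vec_lambda_beta zero_index)
qed

lemma lattice_basis_expand:
  fixes r :: "6 \<Rightarrow> real ^ 6"
  assumes "Z.span (range r) = lat"
  shows "\<exists>c. x = (\<Sum>i\<in>UNIV. c i *\<^sub>R r i)"
proof -
  obtain B where "transpose (vec_lambda r) ** B = mat 1"
    using invertible_transpose_lattice_basis[OF assms] unfolding invertible_def by blast
  then have "x = transpose (vec_lambda r) *v (B *v x)" by (simp add: matrix_vector_mul_assoc)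
  also have "\<dots> = (\<Sum>i\<in>UNIV. (B *v x) $ i *\<^sub>R r i)"
    by (rule transpose_rows_mult_vec)
  finally show ?thesis by blast
qed

section \<open>Normal form of an isotropic plane\<close>

text \<open>This is where the signature (2,4) enters. The form is negative definite on the common
  kernel of the functionals \<open>P\<close> and \<open>R\<close>. Hence (P, R) is injective on the
  isotropic plane, and subtracting from z a vector of the plane moves z into that kernel without
  changing its norm.\<close>

lemma form_semidefinite_perp:
  fixes e1 e2 z :: "real ^ 6"
  assumes "d > 0"
    and e: "form d e1 e1 = 0" "form d e1 e2 = 0" "form d e2 e2 = 0"
    and ind: "\<And>s t. s *\<^sub>R e1 + t *\<^sub>R e2 = 0 \<Longrightarrow> s = 0 \<and> t = 0"
    and z: "form d e1 z = 0" "form d e2 z = 0"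
  shows "form d z z < 0 \<or> (\<exists>s t. z = s *\<^sub>R e1 + t *\<^sub>R e2)"
proof -
  define P where "P u = u$1 + u$2" for u :: "real ^ 6"
  define R where "R u = u$3 + u$4" for u :: "real ^ 6"
  have lin: "P (s *\<^sub>R u + t *\<^sub>R w) = s * P u + t * P w" "R (s *\<^sub>R u + t *\<^sub>R w) = s * R u + t * R w"
    for s t u w by (simp_all add: P_def R_def algebra_simps)
  have neg: "form d u u < 0 \<or> u = 0" if "P u = 0" "R u = 0" for u
  proof -
    have u: "u$2 = - u$1" "u$4 = - u$3" using that by (simp_all add: P_def R_def)
    have "form d u u = - (2 * (u$1)^2 + 2 * (u$3)^2 + 2 * real d * (u$5)^2 + 6 * (u$6)^2)"
      by (simp add: form_def u power2_eq_square)
    moreover have "2 * (u$1)^2 + 2 * (u$3)^2 + 2 * real d * (u$5)^2 + 6 * (u$6)^2 > 0" if "u \<noteq> 0"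
    proof (rule ccontr)
      assume "\<not> ?thesis"
      moreover have "0 \<le> 2 * (u$1)^2" "0 \<le> 2 * (u$3)^2" "0 \<le> 2 * real d * (u$5)^2" "0 \<le> 6 * (u$6)^2"
        by simp_all
      ultimately have "2 * (u$1)^2 = 0" "2 * (u$3)^2 = 0" "2 * real d * (u$5)^2 = 0" "6 * (u$6)^2 = 0"
        by linarith+
      then have "u = 0" using \<open>d > 0\<close> u by (simp add: vec_eq_iff forall_6)
      then show False using that by blast
    qed
    ultimately show ?thesis by (cases "u = 0") auto
  qed
  have isotropic: "form d (s *\<^sub>R e1 + t *\<^sub>R e2) (s *\<^sub>R e1 + t *\<^sub>R e2) = 0" for s t
    using e form_commute[of d e2 e1] by (simp add: form_linear)
  have zero: "s = 0 \<and> t = 0" if "s * P e1 + t * P e2 = 0" "s * R e1 + t * R e2 = 0" for s t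
    using neg[of "s *\<^sub>R e1 + t *\<^sub>R e2"] isotropic[of s t] ind[of s t] that by (simp add: lin)
  define \<Delta> where "\<Delta> = P e1 * R e2 - P e2 * R e1"
  have "\<Delta> \<noteq> 0"
  proof
    assume "\<Delta> = 0"
    then have "R e2 = 0 \<and> - R e1 = 0" "P e2 = 0 \<and> - P e1 = 0"
      by (intro zero; simp add: \<Delta>_def algebra_simps)+
    then show False using zero[of 1 0] by simp
  qed
  \<comment> \<open>Cramer's rule for the vector of the plane on which \<open>P\<close> and
    \<open>R\<close> take the same values as on z; \<Delta> is the determinant of (P, R) on the
    plane.\<close>
  define s where "s = (P z * R e2 - P e2 * R z) / \<Delta>"
  define t where "t = (P e1 * R z - P z * R e1) / \<Delta>"
  define u where "u = z - (s *\<^sub>R e1 + t *\<^sub>R e2)"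
  have "u = 1 *\<^sub>R z + (- 1) *\<^sub>R (s *\<^sub>R e1 + t *\<^sub>R e2)" by (simp add: u_def)
  then have "P u = P z - (s * P e1 + t * P e2)" "R u = R z - (s * R e1 + t * R e2)"
    by (simp_all only: lin) simp_all
  moreover have "s * P e1 + t * P e2 = P z * \<Delta> / \<Delta>" "s * R e1 + t * R e2 = R z * \<Delta> / \<Delta>"
    unfolding s_def t_def by (simp_all add: \<Delta>_def algebra_simps flip: add_divide_distrib)
  ultimately have "P u = 0" "R u = 0" using \<open>\<Delta> \<noteq> 0\<close> by simp_all
  then have "form d u u < 0 \<or> u = 0" by (rule neg)
  moreover have "form d u u = form d z z"
    using z e form_commute[of d e2 e1] form_commute[of d z e1] form_commute[of d z e2]
    by (simp add: u_def form_linear)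
  ultimately show ?thesis by (auto simp: u_def)
qed

text \<open>The order follows the dual pairs: \<open>e1\<close>, \<open>f2\<close> pair to a and
  \<open>e2\<close>, \<open>f1\<close> to 1, with \<open>x\<close>, \<open>y\<close> orthogonal to
  \<open>E\<close>. In the notation of \<open>has_type\<close> these are v1, v6, v2, v5, v3,
  v4.\<close>

definition flag_basis ::
    "nat \<Rightarrow> nat \<Rightarrow> (real ^ 6) set \<Rightarrow> real ^ 6 \<Rightarrow> real ^ 6 \<Rightarrow> real ^ 6 \<Rightarrow> real ^ 6 \<Rightarrow> real ^ 6 \<Rightarrow> real ^ 6 \<Rightarrow> bool" where
  "flag_basis d a E e1 f2 e2 f1 x y \<longleftrightarrow>
     Z.span {e1, f2, e2, f1, x, y} = lat \<and> Z.span {e1, e2} = E \<and>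
     form d e1 e1 = 0 \<and> form d e1 e2 = 0 \<and> form d e2 e2 = 0 \<and>
     form d e1 x = 0 \<and> form d e1 y = 0 \<and> form d e2 x = 0 \<and> form d e2 y = 0 \<and>
     form d e1 f1 = 0 \<and> form d e1 f2 = real a \<and> form d e2 f1 = 1 \<and> form d e2 f2 = 0"

lemma ex_flag_basis:
  assumes "prim_isotropic d 2 E" "has_type d a E"
  shows "\<exists>e1 f2 e2 f1 x y. flag_basis d a E e1 f2 e2 f1 x y"
proof -
  obtain v where v: "int_basis v {1..6} lat" "int_basis v {1..2} E" "int_basis v {1..4} (perp d E)"
    "form d (v 1) (v 5) = 0" "form d (v 1) (v 6) = real a"
    "form d (v 2) (v 5) = 1" "form d (v 2) (v 6) = 0"
    using assms(2) unfolding has_type_def by blast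
  have span: "M = Z.span (v ` I)" if "int_basis v I M" "finite I" for M I
    using that(1) span_image_eq[OF that(2), of v] unfolding int_basis_def by simp
  have "{1..6} = {1, 6, 2, 5, 3, 4::nat}" "{1..2} = {1, 2::nat}" "{1..4} = {1, 2, 3, 4::nat}" by auto
  then have lat: "lat = Z.span {v 1, v 6, v 2, v 5, v 3, v 4}" and E: "E = Z.span {v 1, v 2}"
    and perp: "perp d E = Z.span {v 1, v 2, v 3, v 4}"
    using span[OF v(1)] span[OF v(2)] span[OF v(3)] by simp_all
  have inE: "v 1 \<in> E" "v 2 \<in> E" unfolding E by (auto intro: Z.span_base)
  have "v 3 \<in> perp d E" "v 4 \<in> perp d E" unfolding perp by (auto intro: Z.span_base)
  then have "form d (v i) (v 3) = 0" "form d (v i) (v 4) = 0" if "v i \<in> E" for i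
    using that form_commute[of d "v i"] by (auto simp: perp_def)
  moreover have "form d (v 1) (v 1) = 0" "form d (v 1) (v 2) = 0" "form d (v 2) (v 2) = 0"
    using assms(1) inE by (auto simp: prim_isotropic_def)
  ultimately have "flag_basis d a E (v 1) (v 6) (v 2) (v 5) (v 3) (v 4)"
    using v inE lat E unfolding flag_basis_def by simp
  then show ?thesis by blast
qed

lemma flag_basis_independent:
  assumes "flag_basis d a E e1 f2 e2 f1 x y"
    and "c1 *\<^sub>R e1 + c2 *\<^sub>R f2 + c3 *\<^sub>R e2 + c4 *\<^sub>R f1 + c5 *\<^sub>R x + c6 *\<^sub>R y = 0"
  shows "c1 = 0 \<and> c2 = 0 \<and> c3 = 0 \<and> c4 = 0 \<and> c5 = 0 \<and> c6 = 0"
proof -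
  let ?r = "hexad e1 f2 e2 f1 x y" and ?c = "hexad c1 c2 c3 c4 c5 c6"
  have "Z.span (range ?r) = lat" using assms(1) by (simp add: flag_basis_def range_hexad)
  moreover have "(\<Sum>i\<in>UNIV. ?c i *\<^sub>R ?r i) = 0" using assms(2) by (simp add: sum_6)
  ultimately have "?c i = 0" for i by (rule lattice_basis_independent)
  from this[of 1] this[of 2] this[of 3] this[of 4] this[of 5] this[of 6] show ?thesis by simp
qed

text \<open>The form (A, B, C) is -(z,z)/2 on the span of x and y: integral because the lattice is
  even, positive definite because nonzero vectors there are not in the real span of
  \<open>E\<close>. Its discriminant follows by equating the two expressions for the Gram
  determinant.\<close>

lemma flag_basis_binary_form:
  assumes "flag_basis d a E e1 f2 e2 f1 x y" "d > 0" "a > 0"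
  shows "\<exists>A B C. form d x x = - 2 * of_int A \<and> form d x y = - of_int B \<and> form d y y = - 2 * of_int C
    \<and> bqf_posdef (A, B, C) \<and> (int a)^2 * (4 * A * C - B^2) = 12 * int d"
proof -
  note fb = assms(1)[unfolded flag_basis_def]
  have "x \<in> lat" "y \<in> lat" using fb Z.span_superset[of "{e1, f2, e2, f1, x, y}"] by auto
  obtain A' where A': "form d x x = 2 * of_int A'" using form_lat_even \<open>x \<in> lat\<close> by blast
  obtain C' where C': "form d y y = 2 * of_int C'" using form_lat_even \<open>y \<in> lat\<close> by blast
  obtain B' where B': "form d x y = of_int B'"
    using form_lat_Ints[OF \<open>x \<in> lat\<close> \<open>y \<in> lat\<close>] by (auto simp: Ints_def)
  define A B C where "A = - A'" and "B = - B'" and "C = - C'"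
  have ABC: "form d x x = - 2 * of_int A" "form d x y = - of_int B" "form d y y = - 2 * of_int C"
    by (simp_all add: A' B' C' A_def B_def C_def)
  have pd: "bqf_posdef (A, B, C)" unfolding bqf_posdef_def
  proof (intro allI impI)
    fix m n :: int assume mn: "(m, n) \<noteq> (0, 0)"
    define z where "z = of_int m *\<^sub>R x + of_int n *\<^sub>R y"
    have "form d z z < 0 \<or> (\<exists>s t. z = s *\<^sub>R e1 + t *\<^sub>R e2)"
    proof (rule form_semidefinite_perp)
      show "s = 0 \<and> t = 0" if "s *\<^sub>R e1 + t *\<^sub>R e2 = 0" for s t
        using flag_basis_independent[OF assms(1), of s 0 t 0 0 0] that by simp
    qed (use fb assms(2) in \<open>auto simp: z_def form_linear\<close>)
    moreover have "z \<noteq> s *\<^sub>R e1 + t *\<^sub>R e2" for s t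
      using flag_basis_independent[OF assms(1), of "- s" 0 "- t" 0 "of_int m" "of_int n"] mn
      by (auto simp: z_def algebra_simps)
    ultimately have "form d z z < 0" by blast
    also have "form d z z = of_int (- 2 * bqf (A, B, C) m n)"
      using form_commute[of d y x]
      by (simp add: z_def form_linear ABC power2_eq_square algebra_simps)
    finally have "- 2 * bqf (A, B, C) m n < 0" by (simp only: of_int_less_0_iff)
    then show "0 < bqf (A, B, C) m n" by simp
  qed
  have "real a^2 * (form d x x * form d y y - (form d x y)^2)
      = (det6 e1 f2 e2 f1 x y)^2 * det (form_matrix d)"
    using fb assms(3) bqf_posdef_coeffs_pos(1)[OF pd] by (intro det_gram_isotropic_flag) (auto simp: ABC)
  moreover have "(det6 e1 f2 e2 f1 x y)^2 = 1"
    unfolding det6_def using fb by (intro det_lattice_basis) (simp add: range_hexad)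
  ultimately have "of_int ((int a)^2 * (4 * A * C - B^2)) = (of_int (12 * int d) :: real)"
    using det_form_matrix[OF assms(2)] by (simp add: ABC power2_eq_square mult.assoc)
  then have "(int a)^2 * (4 * A * C - B^2) = 12 * int d" by (simp only: of_int_eq_iff)
  with ABC pd show ?thesis by blast
qed

section \<open>Changes of basis that keep the plane and its pairings\<close>

lemma flag_basis_change_xy:
  assumes "flag_basis d a E e1 f2 e2 f1 x y"
  shows "flag_basis d a E e1 f2 e2 f1 (x + of_int i *\<^sub>R e1 + of_int j *\<^sub>R e2) (y + of_int k *\<^sub>R e1 + of_int l *\<^sub>R e2)"
    (is "flag_basis d a E e1 f2 e2 f1 ?x ?y")
proof -
  have comb: "of_int m *\<^sub>R e1 + of_int n *\<^sub>R e2 \<in> Z.span S" if "e1 \<in> S" "e2 \<in> S" for m n S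
    using that by (intro Z.span_add Z.span_scale Z.span_base)
  have "Z.span {e1, f2, e2, f1, ?x, ?y} = Z.span (insert ?x {e1, f2, e2, f1, ?y})"
    by (rule arg_cong[of _ _ Z.span]) auto
  also have "\<dots> = Z.span (insert x {e1, f2, e2, f1, ?y})"
    using comb[of "{e1, f2, e2, f1, ?y}" i j] by (intro span_insert_cong) simp
  also have "\<dots> = Z.span (insert ?y {e1, f2, e2, f1, x})"
    by (rule arg_cong[of _ _ Z.span]) auto
  also have "\<dots> = Z.span (insert y {e1, f2, e2, f1, x})"
    using comb[of "{e1, f2, e2, f1, x}" k l] by (intro span_insert_cong) simp
  also have "\<dots> = Z.span {e1, f2, e2, f1, x, y}"
    by (rule arg_cong[of _ _ Z.span]) auto
  finally show ?thesis
    using assms form_commute[of d e2 e1] by (simp add: flag_basis_def form_linear)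
qed

lemma flag_basis_change_f2:
  assumes "flag_basis d a E e1 f2 e2 f1 x y"
  shows "flag_basis d a E e1 (f2 + (of_int i *\<^sub>R e1 + of_int j *\<^sub>R e2 + of_int m *\<^sub>R x + of_int n *\<^sub>R y)) e2 f1 x y"
    (is "flag_basis d a E e1 (f2 + ?w) e2 f1 x y")
proof -
  have "Z.span {e1, f2 + ?w, e2, f1, x, y} = Z.span (insert (f2 + ?w) {e1, e2, f1, x, y})"
    by (rule arg_cong[of _ _ Z.span]) auto
  also have "?w \<in> Z.span {e1, e2, f1, x, y}"
    by (intro Z.span_add Z.span_scale Z.span_base) auto
  then have "Z.span (insert (f2 + ?w) {e1, e2, f1, x, y}) = Z.span (insert f2 {e1, e2, f1, x, y})"
    by (intro span_insert_cong) simp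
  also have "\<dots> = Z.span {e1, f2, e2, f1, x, y}"
    by (rule arg_cong[of _ _ Z.span]) auto
  finally show ?thesis
    using assms form_commute[of d e2 e1] by (simp add: flag_basis_def form_linear)
qed

lemma flag_basis_change_f1:
  assumes "flag_basis d a E e1 f2 e2 f1 x y"
  shows "flag_basis d a E e1 f2 e2 (f1 + of_int j *\<^sub>R e2) x y"
    (is "flag_basis d a E e1 f2 e2 (f1 + ?w) x y")
proof -
  have "Z.span {e1, f2, e2, f1 + ?w, x, y} = Z.span (insert (f1 + ?w) {e1, f2, e2, x, y})"
    by (rule arg_cong[of _ _ Z.span]) auto
  also have "\<dots> = Z.span (insert f1 {e1, f2, e2, x, y})"
    by (intro span_insert_cong) (simp add: Z.span_scale Z.span_base)
  also have "\<dots> = Z.span {e1, f2, e2, f1, x, y}"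
    by (rule arg_cong[of _ _ Z.span]) auto
  finally show ?thesis
    using assms form_commute[of d e2 e1] by (simp add: flag_basis_def form_linear)
qed

lemma flag_basis_unimodular:
  assumes "flag_basis d a E e1 f2 e2 f1 x y" "\<alpha> * \<delta> - \<beta> * \<gamma> = 1"
  shows "flag_basis d a E e1 f2 e2 f1 (of_int \<alpha> *\<^sub>R x + of_int \<gamma> *\<^sub>R y) (of_int \<beta> *\<^sub>R x + of_int \<delta> *\<^sub>R y)"
    (is "flag_basis d a E e1 f2 e2 f1 ?x ?y")
proof -
  have det: "of_int \<alpha> * of_int \<delta> - of_int \<beta> * of_int \<gamma> = (1::real)"
    using assms(2) by (metis of_int_1 of_int_diff of_int_mult)
  have "of_int \<delta> *\<^sub>R ?x - of_int \<gamma> *\<^sub>R ?y = (of_int \<alpha> * of_int \<delta> - of_int \<beta> * of_int \<gamma>) *\<^sub>R x"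
    "of_int \<alpha> *\<^sub>R ?y - of_int \<beta> *\<^sub>R ?x = (of_int \<alpha> * of_int \<delta> - of_int \<beta> * of_int \<gamma>) *\<^sub>R y"
    by (simp_all add: algebra_simps)
  then have inv: "x = of_int \<delta> *\<^sub>R ?x - of_int \<gamma> *\<^sub>R ?y" "y = of_int \<alpha> *\<^sub>R ?y - of_int \<beta> *\<^sub>R ?x"
    unfolding det by simp_all
  have "Z.span {e1, f2, e2, f1, ?x, ?y} = Z.span {e1, f2, e2, f1, x, y}"
  proof (subst Z.span_eq, intro conjI)
    let ?S = "{e1, f2, e2, f1, x, y}" and ?T = "{e1, f2, e2, f1, ?x, ?y}"
    have "?x \<in> Z.span ?S" "?y \<in> Z.span ?S" by (intro Z.span_add Z.span_scale Z.span_base; simp)+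
    then show "?T \<subseteq> Z.span ?S" by (auto intro: Z.span_base)
    have "of_int \<delta> *\<^sub>R ?x - of_int \<gamma> *\<^sub>R ?y \<in> Z.span ?T" "of_int \<alpha> *\<^sub>R ?y - of_int \<beta> *\<^sub>R ?x \<in> Z.span ?T"
      by (intro Z.span_diff Z.span_scale Z.span_base; simp)+
    then have "x \<in> Z.span ?T" "y \<in> Z.span ?T" using inv by metis+
    then show "?S \<subseteq> Z.span ?T" by (auto intro: Z.span_base)
  qed
  then show ?thesis using assms(1) by (simp add: flag_basis_def form_linear)
qed

text \<open>The parameters a, k, q fix the whole Gram matrix. The norm of \<open>f2\<close> stays as
  a parameter because adding n \<open>e1\<close> shifts it by 2na, so k can be reduced modulo
  a.\<close>

definition normal_basis ::
    "nat \<Rightarrow> nat \<Rightarrow> nat \<Rightarrow> int \<times> int \<times> int \<Rightarrow> (real ^ 6) set \<Rightarrow>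
      real ^ 6 \<Rightarrow> real ^ 6 \<Rightarrow> real ^ 6 \<Rightarrow> real ^ 6 \<Rightarrow> real ^ 6 \<Rightarrow> real ^ 6 \<Rightarrow> bool" where
  "normal_basis d a k q E e1 f2 e2 f1 x y \<longleftrightarrow> flag_basis d a E e1 f2 e2 f1 x y \<and>
     form d f1 f1 = 0 \<and> form d f1 f2 = 0 \<and> form d f2 f2 = 2 * real k \<and>
     form d x f1 = 0 \<and> form d x f2 = 0 \<and> form d y f1 = 0 \<and> form d y f2 = 0 \<and>
     form d x x = - 2 * of_int (fst q) \<and> form d x y = - of_int (fst (snd q)) \<and>
     form d y y = - 2 * of_int (snd (snd q))"

text \<open>
  Modulo \<open>a\<close> the Gram matrix of \<open>x, y\<close> is invertible, so \<open>f\<^sub>2\<close> can be made orthogonal to \<open>x, y\<close>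
  modulo \<open>a\<close>, and then multiples of \<open>e\<^sub>1\<close> finish the job.
\<close>

lemma ex_normal_basis:
  assumes fb: "flag_basis d a E e1 f2 e2 f1 x y" and "a > 0"
    and xx: "form d x x = - 2 * of_int A" and xy: "form d x y = - of_int B" and yy: "form d y y = - 2 * of_int C"
    and cop: "coprime (int a) (4 * A * C - B^2)" and eq: "proper_equiv (A, B, C) q"
  shows "\<exists>k<a. \<exists>e1 f2 e2 f1 x y. normal_basis d a k q E e1 f2 e2 f1 x y"
proof -
  obtain \<alpha> \<beta> \<gamma> \<delta> where det: "\<alpha> * \<delta> - \<beta> * \<gamma> = 1" and q: "q = bqf_subst \<alpha> \<beta> \<gamma> \<delta> (A, B, C)"
    using eq unfolding proper_equiv_iff by blast
  obtain A' B' C' where q': "q = (A', B', C')" by (cases q)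
  define x1 where "x1 = of_int \<alpha> *\<^sub>R x + of_int \<gamma> *\<^sub>R y"
  define y1 where "y1 = of_int \<beta> *\<^sub>R x + of_int \<delta> *\<^sub>R y"
  have fb1: "flag_basis d a E e1 f2 e2 f1 x1 y1"
    unfolding x1_def y1_def by (rule flag_basis_unimodular[OF fb det])
  have yx: "form d y x = - of_int B" using xy form_commute[of d y x] by simp
  have q1: "form d x1 x1 = - 2 * of_int A'" "form d x1 y1 = - of_int B'" "form d y1 y1 = - 2 * of_int C'"
    using q unfolding q' by (simp_all add: x1_def y1_def form_linear xx xy yx yy power2_eq_square algebra_simps)
  have "bqf_disc q = bqf_disc (A, B, C)" unfolding q bqf_disc_subst det by simp
  then have "4 * A' * C' - B'^2 = 4 * A * C - B^2" by (simp add: q' bqf_disc_def)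
  then have cop': "coprime (int a) (4 * A' * C' - B'^2)" using cop by simp
  define \<Delta> where "\<Delta> = 4 * A' * C' - B'^2"
  note fb1' = fb1[unfolded flag_basis_def]
  have inlat: "e1 \<in> lat" "f2 \<in> lat" "e2 \<in> lat" "f1 \<in> lat" "x1 \<in> lat" "y1 \<in> lat"
    using fb1' Z.span_superset[of "{e1, f2, e2, f1, x1, y1}"] by auto
  have int: "\<exists>n. form d u w = of_int n" if "u \<in> lat" "w \<in> lat" for u w
    using form_lat_Ints[OF that] by (auto simp: Ints_def)
  obtain s t where st: "form d x1 f1 = of_int s" "form d y1 f1 = of_int t"
    using int inlat by meson
  define x2 where "x2 = x1 + of_int 0 *\<^sub>R e1 + of_int (- s) *\<^sub>R e2"
  define y2 where "y2 = y1 + of_int 0 *\<^sub>R e1 + of_int (- t) *\<^sub>R e2"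
  have fb2: "flag_basis d a E e1 f2 e2 f1 x2 y2"
    unfolding x2_def y2_def by (rule flag_basis_change_xy[OF fb1])
  note sym = form_commute[of d e2 e1] form_commute[of d x1 e1] form_commute[of d x1 e2]
    form_commute[of d y1 e1] form_commute[of d y1 e2] form_commute[of d f1 e1] form_commute[of d f1 e2]
    form_commute[of d f2 e1] form_commute[of d f2 e2]
  have q2: "form d x2 x2 = - 2 * of_int A'" "form d x2 y2 = - of_int B'" "form d y2 y2 = - 2 * of_int C'"
    "form d x2 f1 = 0" "form d y2 f1 = 0"
    using fb1' by (simp_all add: x2_def y2_def form_linear q1 st sym)
  note fb2' = fb2[unfolded flag_basis_def]
  have "x2 \<in> lat" "y2 \<in> lat"
    using fb2' Z.span_superset[of "{e1, f2, e2, f1, x2, y2}"] by auto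
  then obtain c1 c2 where c: "form d x2 f2 = of_int c1" "form d y2 f2 = of_int c2"
    using int inlat by meson
  obtain u v where uv: "u * int a + v * \<Delta> = 1"
    using bezout_int[of "int a" \<Delta>] cop' by (auto simp: \<Delta>_def)
  \<comment> \<open>The adjugate of the matrix with rows (2A', B') and (B', 2C'), applied to (c1,
    c2) and multiplied by \<open>v\<close>, the inverse of its determinant \<Delta> modulo
    a.\<close>
  define m where "m = v * (2 * C' * c1 - B' * c2)"
  define n where "n = v * (2 * A' * c2 - B' * c1)"
  have "c1 - 2 * A' * m - B' * n = c1 * (1 - v * \<Delta>)" "c2 - B' * m - 2 * C' * n = c2 * (1 - v * \<Delta>)"
    by (simp_all add: m_def n_def \<Delta>_def power2_eq_square algebra_simps)
  moreover have "1 - v * \<Delta> = int a * u" using uv by (simp add: algebra_simps)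
  ultimately have mn: "c1 - 2 * A' * m - B' * n = int a * (u * c1)" "c2 - B' * m - 2 * C' * n = int a * (u * c2)"
    by (simp_all add: ac_simps)
  define f3 where "f3 = f2 + (of_int 0 *\<^sub>R e1 + of_int 0 *\<^sub>R e2 + of_int m *\<^sub>R x2 + of_int n *\<^sub>R y2)"
  have fb3: "flag_basis d a E e1 f3 e2 f1 x2 y2"
    unfolding f3_def by (rule flag_basis_change_f2[OF fb2])
  have "form d y2 x2 = - of_int B'" using q2(2) form_commute[of d y2 x2] by simp
  then have "form d x2 f3 = of_int (c1 - 2 * A' * m - B' * n)" "form d y2 f3 = of_int (c2 - B' * m - 2 * C' * n)"
    by (simp_all add: f3_def form_linear c q2)
  then have q3: "form d x2 f3 = real a * of_int (u * c1)" "form d y2 f3 = real a * of_int (u * c2)"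
    unfolding mn by simp_all
  define x3 where "x3 = x2 + of_int (- (u * c1)) *\<^sub>R e1 + of_int 0 *\<^sub>R e2"
  define y3 where "y3 = y2 + of_int (- (u * c2)) *\<^sub>R e1 + of_int 0 *\<^sub>R e2"
  have fb4: "flag_basis d a E e1 f3 e2 f1 x3 y3"
    unfolding x3_def y3_def by (rule flag_basis_change_xy[OF fb3])
  have "form d x2 e1 = 0" "form d y2 e1 = 0"
    using fb2' form_commute[of d e1] by metis+
  then have q4: "form d x3 x3 = - 2 * of_int A'" "form d x3 y3 = - of_int B'" "form d y3 y3 = - 2 * of_int C'"
    "form d x3 f1 = 0" "form d y3 f1 = 0" "form d x3 f3 = 0" "form d y3 f3 = 0"
    using fb2' fb3[unfolded flag_basis_def] by (simp_all add: x3_def y3_def form_linear q2 q3)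
  obtain n1 where n1: "form d f1 f1 = 2 * of_int n1" using form_lat_even inlat by blast
  define f1' where "f1' = f1 + of_int (- n1) *\<^sub>R e2"
  have fb5: "flag_basis d a E e1 f3 e2 f1' x3 y3"
    unfolding f1'_def by (rule flag_basis_change_f1[OF fb4])
  note fb4' = fb4[unfolded flag_basis_def]
  have e: "form d x3 e1 = 0" "form d x3 e2 = 0" "form d y3 e1 = 0" "form d y3 e2 = 0"
    "form d f3 e1 = real a" "form d f3 e2 = 0"
    using fb4' form_commute[of d e1] form_commute[of d e2] by metis+
  have q5: "form d f1' f1' = 0" "form d x3 f1' = 0" "form d y3 f1' = 0"
    using fb4' by (simp_all add: f1'_def form_linear n1 e q4 sym)
  note fb5' = fb5[unfolded flag_basis_def]
  have inlat5: "f3 \<in> lat" "f1' \<in> lat"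
    using fb5' Z.span_superset[of "{e1, f3, e2, f1', x3, y3}"] by auto
  obtain N where N: "form d f3 f3 = 2 * of_int N" using form_lat_even inlat5 by blast
  obtain b where b: "form d f1' f3 = of_int b" using int inlat5 by blast
  \<comment> \<open>The multiple of \<open>e2\<close> removes the product with \<open>f1'\<close>
    and leaves the norm alone, since \<open>e2\<close> is orthogonal to \<open>f3\<close> and
    isotropic. The multiple of \<open>e1\<close> replaces half the norm, N, by its remainder modulo
    a.\<close>
  define f4 where "f4 = f3 + (of_int (- (N div int a)) *\<^sub>R e1 + of_int (- b) *\<^sub>R e2 + of_int 0 *\<^sub>R x3 + of_int 0 *\<^sub>R y3)"
  have fb6: "flag_basis d a E e1 f4 e2 f1' x3 y3"
    unfolding f4_def by (rule flag_basis_change_f2[OF fb5])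
  have "form d f1' e1 = 0" "form d f1' e2 = 1" using fb5' form_commute[of d f1'] by metis+
  moreover have "form d f4 f4 = 2 * of_int (N - int a * (N div int a))"
    using fb5' by (simp add: f4_def form_linear N e sym(1) algebra_simps)
  then have "form d f4 f4 = 2 * real (nat (N mod int a))"
    using \<open>a > 0\<close> by (simp add: minus_mult_div_eq_mod)
  ultimately have "normal_basis d a (nat (N mod int a)) q E e1 f4 e2 f1' x3 y3"
    unfolding normal_basis_def q' using fb6 by (simp add: q4 q5) (simp add: f4_def form_linear b q4 e)
  moreover have "nat (N mod int a) < a" using \<open>a > 0\<close> by (simp add: nat_less_iff)
  ultimately show ?thesis by blast
qed

section \<open>Isometries\<close>

lemma matrix_vector_scaleR: "g *v (c *\<^sub>R x) = c *\<^sub>R (g *v x)" for g :: "real ^ 'n ^ 'm"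
  by (rule linear_scale[OF matrix_vector_mul_linear])

lemma matrix_vector_minus: "g *v (- x) = - (g *v x)" for g :: "real ^ 'n ^ 'm"
  by (rule linear_neg[OF matrix_vector_mul_linear])

lemma uminus_mat_one_mult: "- mat 1 *v x = - x" for x :: "real ^ 'n"
proof -
  have "(- mat 1 *v x) $ i = (\<Sum>j\<in>UNIV. if i = j then - x $ j else 0)" for i
    by (simp only: matrix_vector_mult_def vec_lambda_beta) (rule sum.cong, auto simp: mat_def)
  then show ?thesis by (simp add: vec_eq_iff)
qed

lemma image_Z_span:
  fixes g :: "real ^ 6 ^ 6"
  shows "(\<lambda>x. g *v x) ` Z.span S = Z.span ((\<lambda>x. g *v x) ` S)"
proof -
  interpret module_hom "\<lambda>(n::int) (x::real ^ 6). of_int n *\<^sub>R x" "\<lambda>(n::int) (x::real ^ 6). of_int n *\<^sub>R x"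
    "\<lambda>x. g *v x"
    by unfold_locales (simp_all add: matrix_vector_right_distrib matrix_vector_scaleR)
  show ?thesis by (rule span_image[symmetric])
qed

lemma O_realD: "g \<in> O_real d \<Longrightarrow> form d (g *v x) (g *v y) = form d x y"
  by (simp add: O_real_def)

lemma O_real_mult: "g \<in> O_real d \<Longrightarrow> h \<in> O_real d \<Longrightarrow> g ** h \<in> O_real d"
  by (simp add: O_real_def flip: matrix_vector_mul_assoc)

lemma O_lat_mult:
  assumes "g \<in> O_lat d" "h \<in> O_lat d"
  shows "g ** h \<in> O_lat d"
proof -
  have "(\<lambda>x. (g ** h) *v x) ` lat = (\<lambda>x. g *v x) ` (\<lambda>x. h *v x) ` lat"
    by (simp only: image_image matrix_vector_mul_assoc)
  then show ?thesis using assms by (simp add: O_lat_def O_real_mult)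
qed

lemma O_real_left_inverse:
  assumes "d > 0" "g \<in> O_real d"
  shows "\<exists>h. h ** g = mat 1 \<and> g ** h = mat 1"
proof -
  have "x = 0" if "g *v x = 0" for x
  proof (rule form_nondegenerate[OF assms(1)])
    show "form d x y = 0" for y using O_realD[OF assms(2), of x y] that by (simp add: form_zero)
  qed
  then obtain h where "h ** g = mat 1" using matrix_left_invertible_ker[of g] by blast
  then show ?thesis using matrix_left_right_inverse by blast
qed

lemma O_real_inverse:
  assumes "g \<in> O_real d" "g ** h = mat 1"
  shows "h \<in> O_real d"
proof -
  have "g *v (h *v x) = x" for x using assms(2) by (simp add: matrix_vector_mul_assoc)
  then have "form d (h *v x) (h *v y) = form d x y" for x y
    using O_realD[OF assms(1), of "h *v x" "h *v y"] by simp
  then show ?thesis by (simp add: O_real_def)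
qed

lemma O_lat_inverse:
  assumes "g \<in> O_lat d" "g ** h = mat 1" "h ** g = mat 1"
  shows "h \<in> O_lat d"
proof -
  have "h *v (g *v x) = x" for x using assms(3) by (simp add: matrix_vector_mul_assoc)
  then have "(\<lambda>x. h *v x) ` (\<lambda>x. g *v x) ` lat = lat" unfolding image_image by simp
  moreover have "(\<lambda>x. g *v x) ` lat = lat" "g \<in> O_real d" using assms(1) by (simp_all add: O_lat_def)
  ultimately show ?thesis using O_real_inverse[of g d h] assms(2) unfolding O_lat_def by simp
qed

lemma form_sum_left: "form d (\<Sum>i\<in>I. f i) y = (\<Sum>i\<in>I. form d (f i) y)"
  and form_sum_right: "form d y (\<Sum>i\<in>I. f i) = (\<Sum>i\<in>I. form d y (f i))"
  by (induction I rule: infinite_finite_induct) (simp_all add: form_linear)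

text \<open>The linear map matching the two bases preserves the form because all products are
  bilinear in the Gram matrix, and the lattice because both families generate it.\<close>

lemma ex_O_lat_of_same_gram:
  fixes r r' :: "6 \<Rightarrow> real ^ 6"
  assumes "Z.span (range r) = lat" "Z.span (range r') = lat"
    and gram: "\<And>i j. form d (r i) (r j) = form d (r' i) (r' j)"
  shows "\<exists>g\<in>O_lat d. \<forall>i. g *v r i = r' i"
proof -
  obtain B where B: "B ** transpose (vec_lambda r) = mat 1"
    using invertible_transpose_lattice_basis[OF assms(1)] unfolding invertible_def by blast
  define g where "g = transpose (vec_lambda r') ** B"
  have axis: "transpose (vec_lambda s) *v axis i 1 = s i" for s :: "6 \<Rightarrow> real ^ 6" and i
    by (simp add: matrix_vector_mult_basis column_transpose row_def vec_eq_iff)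
  have g: "g *v r i = r' i" for i
  proof -
    have "g *v r i = transpose (vec_lambda r') *v ((B ** transpose (vec_lambda r)) *v axis i 1)"
      by (simp only: g_def axis matrix_vector_mul_assoc[symmetric])
    then show ?thesis by (simp only: B axis matrix_vector_mul_lid)
  qed
  have bil: "form d (\<Sum>i\<in>UNIV. b i *\<^sub>R s i) (\<Sum>i\<in>UNIV. c i *\<^sub>R s i)
      = (\<Sum>i\<in>UNIV. \<Sum>j\<in>UNIV. b i * c j * form d (s i) (s j))" for b c and s :: "6 \<Rightarrow> real ^ 6"
    unfolding form_sum_left unfolding form_sum_right by (simp add: form_linear ac_simps)
  have "g \<in> O_real d" unfolding O_real_def
  proof (intro CollectI allI)
    fix x y
    obtain b c where x: "x = (\<Sum>i\<in>UNIV. b i *\<^sub>R r i)" and y: "y = (\<Sum>i\<in>UNIV. c i *\<^sub>R r i)"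
      using lattice_basis_expand[OF assms(1)] by meson
    have "g *v x = (\<Sum>i\<in>UNIV. b i *\<^sub>R r' i)" "g *v y = (\<Sum>i\<in>UNIV. c i *\<^sub>R r' i)"
      unfolding x y by (simp_all add: matrix_vector_scaleR g
          linear_sum[OF matrix_vector_mul_linear])
    then show "form d (g *v x) (g *v y) = form d x y" unfolding x y by (simp add: bil gram)
  qed
  moreover have "(\<lambda>x. g *v x) ` lat = lat"
  proof -
    have "(\<lambda>x. g *v x) ` range r = range r'" by (simp only: image_image g)
    then show ?thesis using image_Z_span[of g "range r"] assms by simp
  qed
  ultimately show ?thesis using g by (auto simp: O_lat_def)
qed

subsection \<open>Reflections\<close>

lemma refl_mat_mult: "refl_mat d w *v x = x - (2 * form d x w / form d w w) *\<^sub>R w"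
proof -
  have "linear (\<lambda>x. x - (2 * form d x w / form d w w) *\<^sub>R w)"
    by (rule linearI) (simp_all add: form_linear algebra_simps add_divide_distrib)
  then show ?thesis unfolding refl_mat_def by (simp add: matrix_works)
qed

lemma refl_mat_O_real:
  assumes "form d w w \<noteq> 0"
  shows "refl_mat d w \<in> O_real d"
  unfolding O_real_def
proof (intro CollectI allI)
  fix x y
  show "form d (refl_mat d w *v x) (refl_mat d w *v y) = form d x y"
    using assms by (simp add: refl_mat_mult form_linear form_commute[of d w y])
qed

lemma refl_mat_self:
  assumes "form d w w \<noteq> 0"
  shows "refl_mat d w *v w = - w"
  using assms by (simp add: refl_mat_mult scaleR_2)

lemma refl_mat_orthogonal: "form d x w = 0 \<Longrightarrow> refl_mat d w *v x = x"
  by (simp add: refl_mat_mult)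

lemma refl_mat_involution:
  assumes "form d w w \<noteq> 0"
  shows "refl_mat d w ** refl_mat d w = mat 1"
proof -
  have "refl_mat d w *v (refl_mat d w *v x) = x" for x
    using assms by (simp add: refl_mat_mult[of d w] form_linear field_simps scaleR_left_diff_distrib)
  then show ?thesis by (simp add: matrix_eq flip: matrix_vector_mul_assoc)
qed

definition refl_prod :: "nat \<Rightarrow> (real ^ 6) list \<Rightarrow> real ^ 6 ^ 6" where
  "refl_prod d ws = foldr (\<lambda>w h. refl_mat d w ** h) ws (mat 1)"

definition anisotropic_list :: "nat \<Rightarrow> (real ^ 6) list \<Rightarrow> bool" where
  "anisotropic_list d ws \<longleftrightarrow> (\<forall>w\<in>set ws. form d w w \<noteq> 0)"

lemma refl_prod_simps [simp]:
  "refl_prod d [] = mat 1" "refl_prod d (w # ws) = refl_mat d w ** refl_prod d ws"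
  by (simp_all add: refl_prod_def)

lemma refl_prod_append: "refl_prod d (us @ ws) = refl_prod d us ** refl_prod d ws"
  by (induction us) (simp_all add: matrix_mul_assoc)

lemma refl_prod_rev:
  assumes "anisotropic_list d ws"
  shows "refl_prod d (rev ws) ** refl_prod d ws = mat 1"
  using assms
proof (induction ws)
  case (Cons w ws)
  have "refl_prod d (rev (w # ws)) ** refl_prod d (w # ws)
      = refl_prod d (rev ws) ** (refl_mat d w ** refl_mat d w) ** refl_prod d ws"
    by (simp add: refl_prod_append matrix_mul_assoc)
  then show ?case using Cons by (simp add: refl_mat_involution anisotropic_list_def)
qed simp

lemma has_spinor_norm_iff:
  "has_spinor_norm d g s \<longleftrightarrow>
     (\<exists>ws. anisotropic_list d ws \<and> g = refl_prod d ws \<and> s = sgn (\<Prod>w\<leftarrow>ws. - form d w w / 2))"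
  by (simp add: has_spinor_norm_def anisotropic_list_def refl_prod_def)

lemma has_spinor_norm_mult:
  assumes "has_spinor_norm d g s" "has_spinor_norm d h t"
  shows "has_spinor_norm d (g ** h) (s * t)"
proof -
  obtain us where us: "anisotropic_list d us" "g = refl_prod d us" "s = sgn (\<Prod>w\<leftarrow>us. - form d w w / 2)"
    using assms(1) unfolding has_spinor_norm_iff by blast
  obtain ws where ws: "anisotropic_list d ws" "h = refl_prod d ws" "t = sgn (\<Prod>w\<leftarrow>ws. - form d w w / 2)"
    using assms(2) unfolding has_spinor_norm_iff by blast
  show ?thesis unfolding has_spinor_norm_iff
    by (rule exI[of _ "us @ ws"])
      (use us ws in \<open>simp add: refl_prod_append anisotropic_list_def ball_Un sgn_mult\<close>)
qed

lemma has_spinor_norm_inverse: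
  assumes "has_spinor_norm d g s" "g ** h = mat 1"
  shows "has_spinor_norm d h s"
proof -
  obtain ws where ws: "anisotropic_list d ws" "g = refl_prod d ws" "s = sgn (\<Prod>w\<leftarrow>ws. - form d w w / 2)"
    using assms(1) unfolding has_spinor_norm_iff by blast
  have "h = (refl_prod d (rev ws) ** g) ** h" using refl_prod_rev[OF ws(1)] ws(2) by simp
  also have "\<dots> = refl_prod d (rev ws)" using assms(2) by (simp flip: matrix_mul_assoc)
  finally show ?thesis unfolding has_spinor_norm_iff
    by (intro exI[of _ "rev ws"]) (use ws in \<open>simp add: anisotropic_list_def rev_map[symmetric]\<close>)
qed

lemma refl_prod_O_real:
  assumes "anisotropic_list d ws"
  shows "refl_prod d ws \<in> O_real d"
  using assms
proof (induction ws)
  case Nil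
  then show ?case by (simp add: O_real_def)
next
  case (Cons w ws)
  then show ?case by (simp add: anisotropic_list_def O_real_mult refl_mat_O_real)
qed

text \<open>An orthogonal basis of anisotropic vectors, with norms 2, -2, 2, -2, -2d, -6; the
  standard basis contains isotropic vectors, in which no reflection exists.\<close>

definition orth_basis :: "6 \<Rightarrow> real ^ 6" where
  "orth_basis = hexad (axis 1 1 + axis 2 1) (axis 1 1 - axis 2 1)
     (axis 3 1 + axis 4 1) (axis 3 1 - axis 4 1) (axis 5 1) (axis 6 1)"

lemma form_orth_basis:
  "form d (orth_basis 1) (orth_basis 1) = 2" "form d (orth_basis 2) (orth_basis 2) = - 2"
  "form d (orth_basis 3) (orth_basis 3) = 2" "form d (orth_basis 4) (orth_basis 4) = - 2"
  "form d (orth_basis 5) (orth_basis 5) = - 2 * real d" "form d (orth_basis 6) (orth_basis 6) = - 6"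
  by (simp_all add: orth_basis_def form_linear form_axis) (simp_all add: axis_def)

lemma form_orth_basis_neq: "i \<noteq> j \<Longrightarrow> form d (orth_basis i) (orth_basis j) = 0"
  using exhaust_6[of i] exhaust_6[of j]
  by (elim disjE) (simp_all add: orth_basis_def form_linear form_axis, simp_all add: axis_def)

lemma form_orth_basis_nonzero: "d > 0 \<Longrightarrow> form d (orth_basis i) (orth_basis i) \<noteq> 0"
  using exhaust_6[of i] by (elim disjE) (simp_all add: form_orth_basis)

lemma matrix_eq_on_orth_basis:
  fixes g h :: "real ^ 6 ^ 6"
  assumes "\<And>i. g *v orth_basis i = h *v orth_basis i"
  shows "g = h"
proof -
  have half: "axis 1 1 = (1/2) *\<^sub>R (orth_basis 1 + orth_basis 2)"
    "axis 2 1 = (1/2) *\<^sub>R (orth_basis 1 - orth_basis 2)"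
    "axis 3 1 = (1/2) *\<^sub>R (orth_basis 3 + orth_basis 4)"
    "axis 4 1 = (1/2) *\<^sub>R (orth_basis 3 - orth_basis 4)"
    "axis 5 1 = orth_basis 5" "axis 6 1 = orth_basis 6"
    by (simp_all add: orth_basis_def vec_eq_iff)
  have "\<forall>i::6. g *v axis i 1 = h *v axis i 1"
    unfolding forall_6 half
    by (simp only: matrix_vector_scaleR matrix_vector_right_distrib matrix_vector_mult_diff_distrib assms)
  then have "column i g = column i h" for i
    by (simp add: matrix_vector_mult_basis)
  then show ?thesis by (simp add: vec_eq_iff column_def)
qed

text \<open>
  If \<open>g\<close> moves \<open>x\<close> to \<open>y\<close>, then \<open>y - x\<close> or \<open>y + x\<close> is anisotropic, and one or two reflections move
  \<open>y\<close> back to \<open>x\<close> without disturbing the basis vectors orthogonal to \<open>x\<close> and \<open>y\<close>.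
\<close>

lemma ex_refl_prod:
  assumes "d > 0" "g \<in> O_real d"
  shows "\<exists>ws. anisotropic_list d ws \<and> g = refl_prod d ws"
proof -
  let ?b = orth_basis
  have "\<exists>ws. anisotropic_list d ws \<and> g = refl_prod d ws"
    \<comment> \<open>Induction over the set \<open>T\<close> of those basis vectors that g may
      still move.\<close>
    if "finite T" "g \<in> O_real d" "\<forall>i. i \<notin> T \<longrightarrow> g *v ?b i = ?b i" for T g
    using that
  proof (induction T arbitrary: g rule: finite_induct)
    case empty
    then have "g = mat 1" by (intro matrix_eq_on_orth_basis) simp
    then show ?case by (intro exI[of _ "[]"]) (simp add: anisotropic_list_def)
  next
    case (insert i T)
    let ?x = "?b i"
    define y where "y = g *v ?x"
    have yy: "form d y y = form d ?x ?x" using O_realD insert.prems(1) by (simp add: y_def)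
    have xx: "form d ?x ?x \<noteq> 0" using form_orth_basis_nonzero assms(1) by blast
    have orth: "form d (?b j) ?x = 0" "form d (?b j) y = 0" if "j \<notin> insert i T" for j
    proof -
      show 0: "form d (?b j) ?x = 0" using that by (intro form_orth_basis_neq) auto
      have "g *v ?b j = ?b j" using insert.prems(2) that by blast
      then show "form d (?b j) y = 0" using O_realD[OF insert.prems(1), of "?b j" ?x] 0 by (simp add: y_def)
    qed
    have step: "\<exists>ws. anisotropic_list d ws \<and> g = refl_prod d ws"
      if us: "anisotropic_list d us" "refl_prod d us *v y = ?x"
        "\<And>j. j \<notin> insert i T \<Longrightarrow> refl_prod d us *v ?b j = ?b j" for us
    proof -
      define h where "h = refl_prod d us ** g"
      have "h \<in> O_real d"
        unfolding h_def using refl_prod_O_real[OF us(1)] insert.prems(1) by (rule O_real_mult)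
      moreover have "\<forall>j. j \<notin> T \<longrightarrow> h *v ?b j = ?b j"
      proof (intro allI impI)
        fix j assume "j \<notin> T"
        have h: "h *v ?b j = refl_prod d us *v (g *v ?b j)" by (simp only: h_def matrix_vector_mul_assoc)
        show "h *v ?b j = ?b j"
        proof (cases "j = i")
          case True
          then show ?thesis using us(2) h by (simp only: y_def)
        next
          case False
          then have "j \<notin> insert i T" using \<open>j \<notin> T\<close> by blast
          then show ?thesis using us(3) insert.prems(2) h by metis
        qed
      qed
      ultimately obtain ws where ws: "anisotropic_list d ws" "h = refl_prod d ws" using insert.IH by blast
      have "refl_prod d (rev us @ ws) = (refl_prod d (rev us) ** refl_prod d us) ** g"
        unfolding refl_prod_append ws(2)[symmetric] h_def by (simp add: matrix_mul_assoc)
      then have "g = refl_prod d (rev us @ ws)" using refl_prod_rev[OF us(1)] by simp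
      moreover have "anisotropic_list d (rev us @ ws)" using us(1) ws(1) by (auto simp: anisotropic_list_def)
      ultimately show ?thesis by blast
    qed
    note xy = form_commute[of d y ?x]
    show ?case
    proof (cases "form d (y - ?x) (y - ?x) = 0")
      case False
      let ?w = "y - ?x"
      have "2 * form d y ?w = form d ?w ?w" by (simp add: form_linear yy xy)
      then have "refl_mat d ?w *v y = ?x" using False by (simp add: refl_mat_mult)
      moreover have "refl_mat d ?w *v ?b j = ?b j" if "j \<notin> insert i T" for j
        using orth[OF that] by (intro refl_mat_orthogonal) (simp add: form_linear)
      ultimately show ?thesis using False by (intro step[of "[?w]"]) (simp_all add: anisotropic_list_def)
    next
      case True
      let ?w = "y + ?x"
      \<comment> \<open>Parallelogram law: the norms of y - x and y + x add up to 4 times the norm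
        of x, so they cannot both vanish. This reflection takes y to -x, and the one in x restores
        the sign.\<close>
      have w: "form d ?w ?w \<noteq> 0" using True xx by (simp add: form_linear yy xy)
      have "2 * form d y ?w = form d ?w ?w" by (simp add: form_linear yy xy)
      then have "refl_mat d ?w *v y = - ?x" using w by (simp add: refl_mat_mult)
      then have "refl_mat d ?x *v (refl_mat d ?w *v y) = ?x"
        by (simp add: matrix_vector_minus refl_mat_self[OF xx])
      moreover have "refl_mat d ?x *v (refl_mat d ?w *v ?b j) = ?b j" if "j \<notin> insert i T" for j
        using orth[OF that] by (simp add: refl_mat_orthogonal form_linear)
      ultimately show ?thesis using w xx
        by (intro step[of "[?x, ?w]"])
          (simp_all add: anisotropic_list_def flip: matrix_vector_mul_assoc)
    qed
  qed
  from this[of UNIV g] assms(2) show ?thesis by simp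
qed

lemma ex_spinor_norm:
  assumes "d > 0" "g \<in> O_real d"
  shows "has_spinor_norm d g 1 \<or> has_spinor_norm d g (- 1)"
proof -
  obtain ws where ws: "anisotropic_list d ws" "g = refl_prod d ws" using ex_refl_prod assms by blast
  define P where "P = (\<Prod>w\<leftarrow>ws. - form d w w / 2)"
  have "P \<noteq> 0"
    using ws(1) by (auto simp: P_def anisotropic_list_def prod_list_zero_iff)
  then consider "sgn P = 1" | "sgn P = - 1" by (cases "P > 0") (simp_all add: sgn_if)
  moreover have "has_spinor_norm d g (sgn P)"
    using ws unfolding has_spinor_norm_iff P_def by (intro exI[of _ ws]) simp
  ultimately show ?thesis by cases auto
qed

text \<open>Reflecting in all vectors of an orthogonal basis gives -1. Exactly the two vectors of
  positive norm contribute negative factors.\<close>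

lemma has_spinor_norm_uminus_one:
  assumes "d > 0"
  shows "has_spinor_norm d (- mat 1) 1"
proof -
  let ?b = orth_basis
  let ?ws = "[?b 1, ?b 2, ?b 3, ?b 4, ?b 5, ?b 6]"
  have nz: "anisotropic_list d ?ws" using form_orth_basis_nonzero[OF assms] by (simp add: anisotropic_list_def)
  have r: "refl_mat d (?b i) *v ?b j = (if i = j then - ?b j else ?b j)" for i j
    using refl_mat_self[OF form_orth_basis_nonzero[OF assms]] refl_mat_orthogonal[OF form_orth_basis_neq] by auto
  have "- mat 1 = refl_prod d ?ws"
  proof (rule matrix_eq_on_orth_basis)
    show "- mat 1 *v ?b i = refl_prod d ?ws *v ?b i" for i
      using exhaust_6[of i]
      by (elim disjE) (simp_all add: r matrix_vector_minus uminus_mat_one_mult flip: matrix_vector_mul_assoc)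
  qed
  moreover have "sgn (\<Prod>w\<leftarrow>?ws. - form d w w / 2) = 1" using assms by (simp add: form_orth_basis)
  ultimately show ?thesis using nz unfolding has_spinor_norm_iff by (intro exI[of _ ?ws]) simp
qed

section \<open>The group of the modular variety\<close>

text \<open>The isometry acting as \<open>-1\<close> on the plane of \<open>e\<^sub>1, f\<^sub>2\<close> and trivially on its complement.\<close>

lemma ex_negative_stabilizer:
  assumes nb: "normal_basis d a k q E e1 f2 e2 f1 x y" and "a > 0"
  shows "\<exists>s\<in>O_lat d. has_spinor_norm d s (- 1) \<and> (\<lambda>z. s *v z) ` E = E"
proof -
  note nb' = nb[unfolded normal_basis_def flag_basis_def]
  \<comment> \<open>This makes \<open>f2\<close> isotropic over the rationals. The vector f need not
    lie in the lattice, but an isometry that is -1 on \<open>e1\<close> and f is also -1 on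
    \<open>f2\<close>.\<close>
  define f where "f = f2 - (real k / real a) *\<^sub>R e1"
  define u where "u = e1 + f"
  define w where "w = e1 - f"
  have nz: "real a \<noteq> 0" using assms(2) by simp
  note sym = form_commute[of d e2 e1] form_commute[of d f2 e1] form_commute[of d f2 e2]
    form_commute[of d f1 e1] form_commute[of d f2 f1]
  have f: "form d e1 f = real a" "form d f e1 = real a" "form d f f = 0" "form d f2 f = real k"
    "form d e2 f = 0" "form d f1 f = 0" "form d x f = 0" "form d y f = 0" "form d f2 e1 = real a"
    "form d e2 e1 = 0" "form d f1 e1 = 0" "form d x e1 = 0" "form d y e1 = 0"
    using nb' nz form_commute[of d x e1] form_commute[of d y e1]
    by (simp_all add: f_def form_linear sym)
  have norms: "form d u u = 2 * real a" "form d w w = - 2 * real a"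
    using nb' by (simp_all add: u_def w_def form_linear f)
  define s where "s = refl_mat d u ** refl_mat d w"
  have s_mult: "s *v z = refl_mat d u *v (refl_mat d w *v z)" for z
    by (simp only: s_def matrix_vector_mul_assoc)
  have fixed: "s *v z = z" if "form d z e1 = 0" "form d z f = 0" for z
    using that by (simp add: s_mult refl_mat_orthogonal u_def w_def form_linear)
  have we1: "refl_mat d w *v e1 = f" and wf: "refl_mat d w *v f = e1"
    using nb' nz unfolding refl_mat_mult norms by (simp_all add: w_def form_linear f)
  have ue1: "refl_mat d u *v e1 = - f" and uf: "refl_mat d u *v f = - e1"
    using nb' nz unfolding refl_mat_mult norms by (simp_all add: u_def form_linear f)
  have se1: "s *v e1 = - e1" and "s *v f = - f"
    by (simp_all only: s_mult we1 wf ue1 uf)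
  moreover have "f2 = f + (real k / real a) *\<^sub>R e1" by (simp add: f_def)
  ultimately have sf2: "s *v f2 = - f2"
    by (simp add: matrix_vector_right_distrib matrix_vector_scaleR)
  have sfix: "s *v e2 = e2" "s *v f1 = f1" "s *v x = x" "s *v y = y"
    by (rule fixed; simp add: f)+
  have "Z.span {- e1, - f2, e2, f1, x, y} = Z.span {e1, f2, e2, f1, x, y}"
  proof (subst Z.span_eq, intro conjI)
    have neg: "- z \<in> Z.span S" if "z \<in> S" for z S using that by (intro Z.span_neg Z.span_base)
    show "{- e1, - f2, e2, f1, x, y} \<subseteq> Z.span {e1, f2, e2, f1, x, y}"
      using neg[of e1] neg[of f2] by (auto intro: Z.span_base)
    show "{e1, f2, e2, f1, x, y} \<subseteq> Z.span {- e1, - f2, e2, f1, x, y}"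
      using neg[of "- e1"] neg[of "- f2"] by (auto intro: Z.span_base)
  qed
  then have lat: "(\<lambda>z. s *v z) ` lat = lat"
    using image_Z_span[of s "{e1, f2, e2, f1, x, y}"] nb' by (simp add: se1 sf2 sfix)
  have "Z.span {- e1, e2} = Z.span {e1, e2}"
  proof (subst Z.span_eq, intro conjI)
    have neg: "- z \<in> Z.span S" if "z \<in> S" for z S using that by (intro Z.span_neg Z.span_base)
    show "{- e1, e2} \<subseteq> Z.span {e1, e2}" using neg[of e1] by (auto intro: Z.span_base)
    show "{e1, e2} \<subseteq> Z.span {- e1, e2}" using neg[of "- e1"] by (auto intro: Z.span_base)
  qed
  then have E: "(\<lambda>z. s *v z) ` E = E"
    using image_Z_span[of s "{e1, e2}"] nb' by (simp add: se1 sfix)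
  have nz': "form d u u \<noteq> 0" "form d w w \<noteq> 0" using nz norms by simp_all
  have "s \<in> O_real d" unfolding s_def using nz' by (intro O_real_mult refl_mat_O_real)
  \<comment> \<open>The norms 2a and -2a contribute the factors -a and a.\<close>
  moreover have "has_spinor_norm d s (- 1)"
    unfolding has_spinor_norm_iff
    by (rule exI[of _ "[u, w]"])
      (use nz' \<open>a > 0\<close> in \<open>simp add: anisotropic_list_def s_def norms sgn_mult\<close>)
  ultimately show ?thesis using lat E by (auto simp: O_lat_def)
qed

text \<open>An odd prime cannot divide both \<alpha> - 1 and \<alpha> + 1, so the whole of p^2 goes
  into one factor.\<close>

lemma odd_prime_square_dvd_square_minus_one:
  fixes p \<alpha> :: int
  assumes "prime p" "p > 2" "p^2 dvd \<alpha>^2 - 1"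
  shows "p^2 dvd \<alpha> - 1 \<or> p^2 dvd \<alpha> + 1"
proof -
  have eq: "\<alpha>^2 - 1 = (\<alpha> - 1) * (\<alpha> + 1)" by (simp add: power2_eq_square algebra_simps)
  have "\<not> (p dvd \<alpha> - 1 \<and> p dvd \<alpha> + 1)"
  proof
    assume "p dvd \<alpha> - 1 \<and> p dvd \<alpha> + 1"
    then have "p dvd (\<alpha> + 1) - (\<alpha> - 1)" using dvd_diff by blast
    then have "p dvd 2" by simp
    then show False using assms(2) zdvd_imp_le by fastforce
  qed
  then consider "coprime p (\<alpha> - 1)" | "coprime p (\<alpha> + 1)" using assms(1) prime_imp_coprime by blast
  then show ?thesis
  proof cases
    case 1
    then have "coprime (p^2) (\<alpha> - 1)" by simp
    then show ?thesis using assms(3) unfolding eq by (simp add: coprime_dvd_mult_right_iff)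
  next
    case 2
    then have "coprime (p^2) (\<alpha> + 1)" by simp
    then show ?thesis using assms(3) unfolding eq by (simp add: coprime_dvd_mult_left_iff)
  qed
qed

text \<open>
  The image of \<open>v\<^sup>*\<close> in the discriminant group \<open>\<int>/2p\<^sup>2 \<oplus> \<int>/6\<close> is determined by its order and
  its norm up to sign.
\<close>

lemma O_lat_vstar:
  fixes p :: nat
  assumes "prime p" "p > 3" and g: "g \<in> O_lat (p^2)"
  shows "g *v vstar (p^2) - vstar (p^2) \<in> lat \<or> g *v vstar (p^2) + vstar (p^2) \<in> lat"
proof -
  let ?d = "p^2" and ?p = "int p"
  let ?v = "vstar ?d"
  define x where "x = g *v ?v"
  have p0: "p > 0" using assms(2) by simp
  have gO: "g \<in> O_real ?d" and glat: "(\<lambda>x. g *v x) ` lat = lat" using g by (simp_all add: O_lat_def)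
  have v: "form ?d ?v z = - z$5" for z
    using p0 by (simp add: vstar_def form_linear form_commute[of ?d "axis 5 1"] form_axis)
  \<comment> \<open>The image x of \<open>vstar\<close> lies in the dual lattice, so its coordinates
    are integral except for denominators 2d in the fifth and 6 in the sixth.\<close>
  have dual: "form ?d x z \<in> \<int>" if "z \<in> lat" for z
  proof -
    have "z \<in> (\<lambda>x. g *v x) ` lat" unfolding glat by (rule that)
    then obtain z' where z': "z' \<in> lat" "z = g *v z'" by (rule imageE)
    have "form ?d x z = - z'$5" unfolding x_def z'(2) O_realD[OF gO] by (rule v)
    then show ?thesis using Ints_lat[OF z'(1)] by simp
  qed
  have I: "x$1 \<in> \<int>" "x$2 \<in> \<int>" "x$3 \<in> \<int>" "x$4 \<in> \<int>" "- 2 * real ?d * x$5 \<in> \<int>" "- 6 * x$6 \<in> \<int>"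
    using dual[OF axis_in_lat[of 2]] dual[OF axis_in_lat[of 1]] dual[OF axis_in_lat[of 4]]
      dual[OF axis_in_lat[of 3]] dual[OF axis_in_lat[of 5]] dual[OF axis_in_lat[of 6]]
    by (simp_all only: form_axis)
  obtain n1 where n1: "x$1 = of_int n1" using I(1) by (rule Ints_cases)
  obtain n2 where n2: "x$2 = of_int n2" using I(2) by (rule Ints_cases)
  obtain n3 where n3: "x$3 = of_int n3" using I(3) by (rule Ints_cases)
  obtain n4 where n4: "x$4 = of_int n4" using I(4) by (rule Ints_cases)
  obtain m5 where m5: "- 2 * real ?d * x$5 = of_int m5" using I(5) by (rule Ints_cases)
  obtain m6 where m6: "- 6 * x$6 = of_int m6" using I(6) by (rule Ints_cases)
  define \<alpha> where "\<alpha> = - m5"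
  have x5: "2 * real ?d * x$5 = of_int \<alpha>" using m5 by (simp add: \<alpha>_def)
  \<comment> \<open>The order of \<open>vstar\<close> modulo the lattice divides 2p^2, and so does
    that of x. As 3 does not divide p, the denominator 6 of the last coordinate drops to 2.\<close>
  have "(2 * real ?d) *\<^sub>R ?v \<in> lat" using p0 by (simp add: vstar_def axis_in_lat)
  then have "g *v ((2 * real ?d) *\<^sub>R ?v) \<in> (\<lambda>x. g *v x) ` lat" by (rule imageI)
  then have "g *v ((2 * real ?d) *\<^sub>R ?v) \<in> lat" unfolding glat .
  then have "(2 * real ?d) *\<^sub>R x \<in> lat" by (simp add: x_def matrix_vector_scaleR)
  from Ints_lat[OF this, of 6] have "2 * real ?d * x$6 \<in> \<int>" by simp
  then obtain l where l: "2 * real ?d * x$6 = of_int l" by (auto simp: Ints_def)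
  have "of_int (?p^2 * m6) = (of_int (- 3 * l) :: real)"
  proof -
    have "of_int (?p^2 * m6) = real ?d * of_int m6" by simp
    also have "\<dots> = - 3 * (2 * real ?d * x$6)" unfolding m6[symmetric] by simp
    also have "\<dots> = of_int (- 3 * l)" unfolding l by simp
    finally show ?thesis .
  qed
  then have "?p^2 * m6 = - 3 * l" by (simp only: of_int_eq_iff)
  then have "3 dvd ?p^2 * m6" by simp
  moreover have "\<not> 3 dvd ?p"
  proof
    assume "3 dvd ?p"
    then have "3 dvd p" by (metis int_dvd_int_iff of_nat_numeral)
    then have "3 = p" using assms(1) by (auto simp: prime_nat_iff)
    then show False using assms(2) by simp
  qed
  moreover have "prime (3::int)" by simp
  ultimately have "3 dvd m6" using prime_dvd_multD[of 3 "?p^2" m6] prime_dvd_power[of 3 ?p 2] by blast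
  then obtain \<beta>' where "m6 = 3 * \<beta>'" by blast
  define \<beta> where "\<beta> = - \<beta>'"
  have x6: "2 * x$6 = of_int \<beta>" using m6 \<open>m6 = 3 * \<beta>'\<close> by (simp add: \<beta>_def)
  define N where "N = n1 * n2 + n3 * n4"
  \<comment> \<open>Comparing norms and clearing denominators gives an integral equation which says
    that \<alpha>^2 is 1 modulo p^2.\<close>
  have "form ?d x x = form ?d ?v ?v" using O_realD[OF gO] by (simp add: x_def)
  also have "\<dots> = - 1 / (2 * real ?d)" unfolding v by (simp add: vstar_def)
  finally have xx: "2 * real ?d * form ?d x x = - 1" using p0 by simp
  have "2 * real ?d * form ?d x x
      = 2 * real ?d * (2 * (x$1 * x$2 + x$3 * x$4)) - (2 * real ?d * x$5)^2 - 3 * real ?d * (2 * x$6)^2"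
    by (simp add: form_def power2_eq_square algebra_simps)
  then have "(of_int (4 * ?p^2 * N - \<alpha>^2 - 3 * ?p^2 * \<beta>^2) :: real) = of_int (- 1)"
    unfolding xx x5 x6 by (simp add: n1 n2 n3 n4 N_def algebra_simps)
  then have eq: "4 * ?p^2 * N - \<alpha>^2 - 3 * ?p^2 * \<beta>^2 = - 1" by (simp only: of_int_eq_iff)
  have pp: "prime ?p" "?p > 2" using assms by simp_all
  have "\<alpha>^2 - 1 = ?p^2 * (4 * N - 3 * \<beta>^2)" using eq by (simp add: algebra_simps)
  then have "?p^2 dvd \<alpha> - 1 \<or> ?p^2 dvd \<alpha> + 1"
    using odd_prime_square_dvd_square_minus_one[OF pp, of \<alpha>] by simp
  have "odd ?p" using pp prime_odd_int by blast
  \<comment> \<open>The prime 2 is settled modulo 4, where p^2 is 1: an odd \<beta> would make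
    \<alpha>^2 equal to 2. Hence \<beta> is even, so the last coordinate is integral, and \<alpha>
    is odd, which improves p^2 to 2p^2.\<close>
  have sq: "(n::int)^2 mod 4 = (if even n then 0 else 1)" for n
  proof (cases "even n")
    case True
    then show ?thesis by (auto simp: power2_eq_square)
  next
    case False
    then obtain k where "n = 2 * k + 1" by (auto elim: oddE)
    then have "n^2 = 4 * (k * k + k) + 1" by (simp add: power2_eq_square algebra_simps)
    then have "n^2 mod 4 = 1 mod 4" by (metis add.commute mod_mult_self2)
    then show ?thesis using False by simp
  qed
  have "?p^2 mod 4 = 1" using sq[of ?p] \<open>odd ?p\<close> by simp
  then have t: "?p^2 = 4 * (?p^2 div 4) + 1" using mult_div_mod_eq[of 4 "?p^2"] by simp
  define t where "t = ?p^2 div 4"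
  have \<alpha>: "\<alpha>^2 = (4 * t + 1) * (4 * N - 3 * \<beta>^2) + 1"
    using \<open>\<alpha>^2 - 1 = ?p^2 * (4 * N - 3 * \<beta>^2)\<close> t unfolding t_def[symmetric] by simp
  have "even \<beta>"
  proof (rule ccontr)
    assume "odd \<beta>"
    then have "\<beta>^2 mod 4 = 1" using sq[of \<beta>] by simp
    then have b: "\<beta>^2 = 4 * (\<beta>^2 div 4) + 1" using mult_div_mod_eq[of 4 "\<beta>^2"] by simp
    define b where "b = \<beta>^2 div 4"
    have "\<alpha>^2 = 2 + 4 * (t * (4 * N - 12 * b - 3) + N - 3 * b - 1)"
      using b unfolding \<alpha> b_def[symmetric] by (simp add: algebra_simps)
    then have "\<alpha>^2 mod 4 = 2 mod 4" by (simp only: mod_mult_self2)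
    then show False using sq[of \<alpha>] by (simp split: if_splits)
  qed
  then obtain b where b: "\<beta> = 2 * b" by blast
  have "\<alpha>^2 = 1 + 4 * ((4 * t + 1) * (N - 3 * b^2))"
    unfolding \<alpha> b by (simp add: algebra_simps)
  then have "\<alpha>^2 mod 4 = 1 mod 4" by (simp only: mod_mult_self2)
  then have "odd \<alpha>" using sq[of \<alpha>] by (simp split: if_splits)
  note ev = \<open>even \<beta>\<close> \<open>odd \<alpha>\<close>
  have x6Z: "x$6 \<in> \<int>"
  proof -
    obtain b where "\<beta> = 2 * b" using ev(1) by blast
    then have "x$6 = of_int b" using x6 by simp
    then show ?thesis by simp
  qed
  have "coprime (2::int) (?p^2)" using \<open>odd ?p\<close> by simp
  then have two: "2 * ?p^2 dvd m" if "even m" "?p^2 dvd m" for m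
    using that by (intro divides_mult) auto
  have fin: "x - c *\<^sub>R ?v \<in> lat" if dvd: "2 * ?p^2 dvd \<alpha> - c'" and c: "c = of_int c'" for c c'
  proof -
    obtain j where "\<alpha> - c' = 2 * ?p^2 * j" using dvd by blast
    then have "of_int \<alpha> - c = 2 * real ?d * of_int j"
    proof -
      have "real_of_int (\<alpha> - c') = of_int (2 * ?p^2 * j)" by (simp only: \<open>\<alpha> - c' = 2 * ?p^2 * j\<close>)
      then show ?thesis using c by simp
    qed
    then have "2 * real ?d * (x$5 - c * ?v$5) = 2 * real ?d * of_int j"
      using p0 unfolding right_diff_distrib x5 by (simp add: vstar_def)
    then have "x$5 - c * ?v$5 = of_int j" using p0 by simp
    then have "x$5 - c * ?v$5 \<in> \<int>" by simp
    then show ?thesis using I x6Z by (simp add: lat_def forall_6 vstar_def axis_def)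
  qed
  show ?thesis
    using \<open>?p^2 dvd \<alpha> - 1 \<or> ?p^2 dvd \<alpha> + 1\<close>
  proof
    assume "?p^2 dvd \<alpha> - 1"
    then show ?thesis using fin[of 1 1] two[of "\<alpha> - 1"] ev(2) by (simp add: x_def)
  next
    assume "?p^2 dvd \<alpha> + 1"
    then show ?thesis using fin[of "- 1" "- 1"] two[of "\<alpha> + 1"] ev(2) by (simp add: x_def)
  qed
qed

section \<open>Group laws for \<open>Gamma\<close> and equivalence of planes with the same normal
  form\<close>

lemma Gamma_mult:
  assumes "g \<in> Gamma d" "h \<in> Gamma d"
  shows "g ** h \<in> Gamma d"
proof -
  have glat: "(\<lambda>x. g *v x) ` lat = lat" using assms by (simp add: Gamma_def O_plus_lat_def O_lat_def)
  have sum: "(g ** h) *v vstar d - vstar d = g *v (h *v vstar d - vstar d) + (g *v vstar d - vstar d)"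
    by (simp add: matrix_vector_mult_diff_distrib flip: matrix_vector_mul_assoc)
  have "g *v (h *v vstar d - vstar d) \<in> lat" "g *v vstar d - vstar d \<in> lat"
    using assms glat by (auto simp: Gamma_def)
  then have "(g ** h) *v vstar d - vstar d \<in> lat"
    unfolding sum by (rule Z.subspace_add[OF subspace_lat])
  moreover have "has_spinor_norm d (g ** h) 1"
    using assms has_spinor_norm_mult[of d g 1 h 1] by (simp add: Gamma_def O_plus_lat_def O_plus_real_def)
  ultimately show ?thesis
    using assms O_lat_mult O_real_mult by (simp add: Gamma_def O_plus_lat_def O_plus_real_def)
qed

lemma Gamma_inverse:
  assumes "d > 0" "g \<in> Gamma d"
  shows "\<exists>h\<in>Gamma d. h ** g = mat 1 \<and> g ** h = mat 1"
proof -
  have g: "g \<in> O_real d" "g \<in> O_lat d" "has_spinor_norm d g 1" "g *v vstar d - vstar d \<in> lat"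
    using assms(2) by (simp_all add: Gamma_def O_plus_lat_def O_plus_real_def)
  obtain h where h: "h ** g = mat 1" "g ** h = mat 1" using O_real_left_inverse[OF assms(1) g(1)] by blast
  have "h \<in> O_lat d" using O_lat_inverse g h by blast
  then have hlat: "(\<lambda>x. h *v x) ` lat = lat" by (simp add: O_lat_def)
  have "h *v (g *v vstar d) = vstar d" using h(1) by (simp add: matrix_vector_mul_assoc)
  then have "h *v vstar d - vstar d = - (h *v (g *v vstar d - vstar d))"
    by (simp add: matrix_vector_mult_diff_distrib)
  moreover have "h *v (g *v vstar d - vstar d) \<in> lat" using g(4) hlat by blast
  ultimately have "h *v vstar d - vstar d \<in> lat" using Z.subspace_neg[OF subspace_lat] by simp
  moreover have "has_spinor_norm d h 1" using has_spinor_norm_inverse g(3) h(2) by blast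
  ultimately have "h \<in> Gamma d"
    using \<open>h \<in> O_lat d\<close> by (simp add: Gamma_def O_plus_lat_def O_plus_real_def O_lat_def)
  then show ?thesis using h by blast
qed

lemma normal_basis_gram:
  assumes "normal_basis d a k q E e1 f2 e2 f1 x y"
  shows "form d (hexad e1 f2 e2 f1 x y i) (hexad e1 f2 e2 f1 x y j)
    = hexad (hexad 0 (real a) 0 0 0 0) (hexad (real a) (2 * real k) 0 0 0 0)
        (hexad 0 0 0 1 0 0) (hexad 0 0 1 0 0 0)
        (hexad 0 0 0 0 (- 2 * of_int (fst q)) (- of_int (fst (snd q))))
        (hexad 0 0 0 0 (- of_int (fst (snd q))) (- 2 * of_int (snd (snd q)))) i j"
proof -
  note n = assms[unfolded normal_basis_def flag_basis_def]
  note sym = form_commute[of d f2 e1] form_commute[of d e2 e1] form_commute[of d f1 e1]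
    form_commute[of d x e1] form_commute[of d y e1] form_commute[of d f2 e2] form_commute[of d f2 f1]
    form_commute[of d f2 x] form_commute[of d f2 y] form_commute[of d f1 e2] form_commute[of d x e2]
    form_commute[of d y e2] form_commute[of d f1 x] form_commute[of d f1 y] form_commute[of d y x]
  show ?thesis
    using exhaust_6[of i] exhaust_6[of j] by (elim disjE) (simp_all add: n sym)
qed

lemma ex_Gamma_of_same_normal_form:
  fixes p :: nat
  assumes "prime p" "p > 3" "a > 0"
    and nb: "normal_basis (p^2) a k q E e1 f2 e2 f1 x y"
    and nb': "normal_basis (p^2) a k q E' e1' f2' e2' f1' x' y'"
  shows "\<exists>g\<in>Gamma (p^2). (\<lambda>z. g *v z) ` E = E'"
proof -
  let ?d = "p^2"
  have d: "?d > 0" using assms(2) by simp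
  let ?r = "hexad e1 f2 e2 f1 x y" and ?r' = "hexad e1' f2' e2' f1' x' y'"
  note n = nb[unfolded normal_basis_def flag_basis_def]
  note n' = nb'[unfolded normal_basis_def flag_basis_def]
  have "form ?d (?r i) (?r j) = form ?d (?r' i) (?r' j)" for i j
    unfolding normal_basis_gram[OF nb] normal_basis_gram[OF nb'] ..
  then obtain g where g: "g \<in> O_lat ?d" "\<And>i. g *v ?r i = ?r' i"
    using ex_O_lat_of_same_gram[of ?r ?r' ?d] n n' by (auto simp: range_hexad)
  have gE: "(\<lambda>z. g *v z) ` E = E'"
    using image_Z_span[of g "{e1, e2}"] n n' g(2)[of 1] g(2)[of 3] by simp
  obtain s where s: "s \<in> O_lat ?d" "has_spinor_norm ?d s (- 1)" "(\<lambda>z. s *v z) ` E = E"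
    using ex_negative_stabilizer[OF nb assms(3)] by blast
  have "\<exists>g\<in>O_plus_lat ?d. (\<lambda>z. g *v z) ` E = E'"
  proof (cases "has_spinor_norm ?d g 1")
    case True
    then show ?thesis using g(1) gE by (auto simp: O_plus_lat_def O_plus_real_def O_lat_def)
  next
    case False
    then have "has_spinor_norm ?d g (- 1)" using ex_spinor_norm[OF d] g(1) by (auto simp: O_lat_def)
    then have "has_spinor_norm ?d (g ** s) 1" using has_spinor_norm_mult s(2) by fastforce
    moreover have "g ** s \<in> O_lat ?d" using O_lat_mult g(1) s(1) by blast
    moreover have "(\<lambda>z. (g ** s) *v z) ` E = (\<lambda>z. g *v z) ` (\<lambda>z. s *v z) ` E"
      by (simp only: image_image matrix_vector_mul_assoc)
    then have "(\<lambda>z. (g ** s) *v z) ` E = E'" by (simp only: s(3) gE)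
    ultimately show ?thesis by (intro bexI[of _ "g ** s"]) (auto simp: O_plus_lat_def O_plus_real_def O_lat_def)
  qed
  then obtain h where h: "h \<in> O_plus_lat ?d" "(\<lambda>z. h *v z) ` E = E'" by blast
  have "h \<in> O_lat ?d" using h(1) by (simp add: O_plus_lat_def)
  \<comment> \<open>The sign on \<open>vstar\<close> is corrected last: \<open>- mat 1\<close> has
    spinor norm 1 and maps every subgroup to itself, so what has been arranged already
    survives.\<close>
  from O_lat_vstar[OF assms(1,2) this] show ?thesis
  proof
    assume "h *v vstar ?d - vstar ?d \<in> lat"
    then show ?thesis using h by (auto simp: Gamma_def)
  next
    assume v: "h *v vstar ?d + vstar ?d \<in> lat"
    let ?h = "- mat 1 ** h"
    have mult: "?h *v z = - (h *v z)" for z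
      by (simp only: matrix_vector_mul_assoc[symmetric] uminus_mat_one_mult)
    have neg: "uminus ` Z.span S = Z.span S" for S
    proof -
      have "z \<in> uminus ` Z.span S" if "z \<in> Z.span S" for z
        using Z.span_neg[OF that] by (intro image_eqI[of _ _ "- z"]) auto
      then show ?thesis using Z.span_neg by blast
    qed
    have "lat = Z.span {e1, f2, e2, f1, x, y}" "E' = Z.span {e1', e2'}" using n n' by simp_all
    then have neg': "uminus ` lat = lat" "uminus ` E' = E'" using neg by metis+
    have "(\<lambda>z. ?h *v z) ` S = uminus ` (\<lambda>z. h *v z) ` S" for S unfolding mult image_image ..
    then have im: "(\<lambda>z. ?h *v z) ` E = E'" "(\<lambda>z. ?h *v z) ` lat = lat"
      using h neg' by (simp_all add: O_plus_lat_def O_lat_def)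
    have "h \<in> O_real ?d" using h(1) by (simp add: O_plus_lat_def O_lat_def)
    then have "form ?d (?h *v z) (?h *v z') = form ?d z z'" for z z'
      unfolding mult by (simp add: form_linear O_realD)
    then have "?h \<in> O_real ?d" unfolding O_real_def by blast
    moreover have "has_spinor_norm ?d ?h 1"
      using has_spinor_norm_mult[OF has_spinor_norm_uminus_one[OF d], of h 1] h(1)
      by (simp add: O_plus_lat_def O_plus_real_def)
    moreover have "?h *v vstar ?d - vstar ?d = - (h *v vstar ?d + vstar ?d)" by (simp add: mult)
    then have "?h *v vstar ?d - vstar ?d \<in> lat" using Z.subspace_neg[OF subspace_lat v] by simp
    ultimately have "?h \<in> Gamma ?d"
      using im(2) unfolding Gamma_def O_plus_lat_def O_plus_real_def O_lat_def by blast
    then show ?thesis using im(1) by blast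
  qed
qed

section \<open>Boundary curves\<close>

abbreviation complex_matrix :: "real ^ 6 ^ 6 \<Rightarrow> complex ^ 6 ^ 6" where
  "complex_matrix g \<equiv> map_matrix complex_of_real g"

lemma complex_matrix_mult: "complex_matrix (g ** h) = complex_matrix g ** complex_matrix h"
  by (simp add: vec_eq_iff map_matrix_def matrix_matrix_mult_def)

lemma complex_matrix_one: "complex_matrix (mat 1) = mat 1"
  by (simp add: vec_eq_iff map_matrix_def mat_def)

lemma complex_matrix_mult_vec:
  "(\<chi> i. Re ((complex_matrix g *v x) $ i)) = g *v (\<chi> i. Re (x $ i))"
  "(\<chi> i. Im ((complex_matrix g *v x) $ i)) = g *v (\<chi> i. Im (x $ i))"
  "conj_vec (complex_matrix g *v x) = complex_matrix g *v conj_vec x"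
  by (simp_all add: vec_eq_iff map_matrix_def matrix_vector_mult_def conj_vec_def)

lemma act_proj: "act g (proj x) = proj (complex_matrix g *v x)"
  unfolding act_def proj_def image_image by (simp add: vector_scalar_commute)

lemma act_act: "act g (act h P) = act (g ** h) P"
  by (simp add: act_def image_image complex_matrix_mult matrix_vector_mul_assoc)

lemma act_one: "act (mat 1) P = P"
  by (simp add: act_def complex_matrix_one)

lemma complex_matrix_eq_0_iff:
  assumes "h ** g = mat 1"
  shows "complex_matrix g *v x = 0 \<longleftrightarrow> x = 0"
proof
  assume "complex_matrix g *v x = 0"
  then have "complex_matrix (h ** g) *v x = 0"
    unfolding complex_matrix_mult matrix_vector_mul_assoc[symmetric] by simp
  then show "x = 0" by (simp add: assms complex_matrix_one)
qed simp

lemma act_proj_space: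
  assumes "h ** g = mat 1" "P \<in> proj_space"
  shows "act g P \<in> proj_space"
proof -
  obtain x where "P = proj x" "x \<noteq> 0" using assms(2) by (auto simp: proj_space_def)
  then show ?thesis
    using complex_matrix_eq_0_iff[OF assms(1)] by (auto simp: proj_space_def act_proj)
qed

lemma topspace_proj_top: "topspace proj_top = proj_space"
proof -
  have "{x. x \<noteq> 0 \<and> proj x \<in> proj_space} = - {0}" by (auto simp: proj_space_def)
  then have "openin proj_top proj_space" by (simp add: openin_proj_top open_Compl)
  then have "proj_space \<subseteq> topspace proj_top" by (rule openin_subset)
  moreover have "topspace proj_top \<subseteq> proj_space"
    using openin_proj_top[of "topspace proj_top"] openin_topspace[of proj_top] by simp
  ultimately show ?thesis by blast
qed

text \<open>The action is continuous for the quotient topology because the linear map upstairs is;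
  so a neighbourhood of the image pulls back to a neighbourhood of P, which meets D, and g preserves
  D.\<close>

lemma act_closure_of:
  assumes "h ** g = mat 1" "act g ` D = D" "P \<in> proj_top closure_of D"
  shows "act g P \<in> proj_top closure_of D"
  unfolding in_closure_of topspace_proj_top
proof (intro conjI allI impI)
  have P: "P \<in> proj_space" and cl: "\<And>T. P \<in> T \<and> openin proj_top T \<Longrightarrow> \<exists>Q. Q \<in> D \<and> Q \<in> T"
    using assms(3) unfolding in_closure_of topspace_proj_top by blast+
  show "act g P \<in> proj_space" by (rule act_proj_space[OF assms(1) P])
  fix T assume T: "act g P \<in> T \<and> openin proj_top T"
  let ?T = "{Q \<in> proj_space. act g Q \<in> T}"
  have "{x. x \<noteq> 0 \<and> proj x \<in> ?T} = (\<lambda>x. complex_matrix g *v x) -` {x. x \<noteq> 0 \<and> proj x \<in> T}"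
    using complex_matrix_eq_0_iff[OF assms(1)] by (auto simp: act_proj proj_space_def)
  moreover have "open ((\<lambda>x. complex_matrix g *v x) -` {x. x \<noteq> 0 \<and> proj x \<in> T})"
  proof (rule open_vimage)
    show "open {x. x \<noteq> 0 \<and> proj x \<in> T}" using T by (simp add: openin_proj_top)
    show "continuous_on UNIV (\<lambda>x. complex_matrix g *v x)"
      unfolding matrix_vector_mult_def by (intro continuous_intros)
  qed
  ultimately have "openin proj_top ?T" by (auto simp: openin_proj_top)
  then obtain Q where "Q \<in> D" "Q \<in> ?T" using cl[of ?T] P T by blast
  then show "\<exists>Q. Q \<in> D \<and> Q \<in> T" using assms(2) by blast
qed

text \<open>A real matrix commutes with conjugation, so non-real points stay non-real. Since g
  preserves the closure of D, the half plane selected for \<open>E\<close> goes into the one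
  selected for the image.\<close>

lemma act_bd_curve:
  assumes "h ** g = mat 1" "act g ` D = D" "P \<in> bd_curve D E"
  shows "act g P \<in> bd_curve D ((\<lambda>z. g *v z) ` E)"
proof -
  obtain x where x: "P = proj x" "x \<in> complexify E" "x \<noteq> 0" "proj x \<noteq> proj (conj_vec x)"
    "proj x \<in> proj_top closure_of D" using assms(3) unfolding bd_curve_def by blast
  let ?y = "complex_matrix g *v x"
  have "span ((\<lambda>z. g *v z) ` E) = (\<lambda>z. g *v z) ` span E"
    by (rule linear_span_image[OF matrix_vector_mul_linear])
  then have "?y \<in> complexify ((\<lambda>z. g *v z) ` E)"
    using x(2) by (auto simp: complexify_def complex_matrix_mult_vec)
  moreover have "?y \<noteq> 0" using x(3) complex_matrix_eq_0_iff[OF assms(1)] by blast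
  moreover have "proj ?y \<noteq> proj (conj_vec ?y)"
  proof
    assume "proj ?y = proj (conj_vec ?y)"
    then have "act g (proj x) = act g (proj (conj_vec x))" by (simp add: act_proj complex_matrix_mult_vec)
    then have "act h (act g (proj x)) = act h (act g (proj (conj_vec x)))" by simp
    then show False using x(4) by (simp add: act_act assms(1) act_one)
  qed
  moreover have "proj ?y \<in> proj_top closure_of D"
    using act_closure_of[OF assms(1,2) x(5)] by (simp add: act_proj)
  ultimately show ?thesis unfolding bd_curve_def x(1) act_proj by blast
qed

section \<open>Curves of equivalent planes coincide in the compactification\<close>

lemma orbit_class_act:
  assumes "d > 0" "g \<in> Gamma d" "P \<in> X" "act g P \<in> X"
  shows "orbit_rel (Gamma d) X `` {act g P} = orbit_rel (Gamma d) X `` {P}"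
proof -
  obtain h where h: "h \<in> Gamma d" "h ** g = mat 1" using Gamma_inverse[OF assms(1,2)] by blast
  show ?thesis
  proof (intro equalityI subsetI)
    fix Q assume "Q \<in> orbit_rel (Gamma d) X `` {act g P}"
    then obtain g' where g': "Q \<in> X" "g' \<in> Gamma d" "Q = act g' (act g P)" unfolding orbit_rel_def by blast
    then have "Q = act (g' ** g) P" by (simp only: act_act)
    then show "Q \<in> orbit_rel (Gamma d) X `` {P}"
      using Gamma_mult[OF g'(2) assms(2)] g'(1) assms(3) unfolding orbit_rel_def by blast
  next
    fix Q assume "Q \<in> orbit_rel (Gamma d) X `` {P}"
    then obtain g' where g': "Q \<in> X" "g' \<in> Gamma d" "Q = act g' P" unfolding orbit_rel_def by blast
    have "act (g' ** h) (act g P) = act (g' ** (h ** g)) P" by (simp only: act_act matrix_mul_assoc)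
    then have "Q = act (g' ** h) (act g P)" using g'(3) h(2) by simp
    then show "Q \<in> orbit_rel (Gamma d) X `` {act g P}"
      using Gamma_mult[OF g'(2) h(1)] g'(1) assms(4) unfolding orbit_rel_def by blast
  qed
qed

lemma bd_curve_subset_extended_domain:
  "prim_isotropic d 2 E \<Longrightarrow> bd_curve D E \<subseteq> extended_domain d D"
  unfolding extended_domain_def by (rule le_supI1, rule le_supI2, rule UN_upper) simp

lemma cusp_curve_image_subset:
  assumes "d > 0" "is_period_domain d D" "g \<in> Gamma d"
    and "prim_isotropic d 2 E" "prim_isotropic d 2 ((\<lambda>z. g *v z) ` E)"
  shows "cusp_curve d (Gamma d) D E \<subseteq> cusp_curve d (Gamma d) D ((\<lambda>z. g *v z) ` E)"
proof
  fix c assume "c \<in> cusp_curve d (Gamma d) D E"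
  then obtain P where P: "P \<in> bd_curve D E" "c = orbit_rel (Gamma d) (extended_domain d D) `` {P}"
    by (auto simp: cusp_curve_def elim: quotientE)
  obtain h where h: "h ** g = mat 1" using Gamma_inverse[OF assms(1,3)] by blast
  have "act g ` D = D"
    using assms(2,3) by (simp add: is_period_domain_def Gamma_def O_plus_lat_def)
  then have Q: "act g P \<in> bd_curve D ((\<lambda>z. g *v z) ` E)" by (rule act_bd_curve[OF h _ P(1)])
  have "P \<in> extended_domain d D" "act g P \<in> extended_domain d D"
    using bd_curve_subset_extended_domain P(1) Q assms(4,5) by blast+
  then have "c = orbit_rel (Gamma d) (extended_domain d D) `` {act g P}"
    unfolding P(2) by (rule orbit_class_act[OF assms(1,3), symmetric])
  then show "c \<in> cusp_curve d (Gamma d) D ((\<lambda>z. g *v z) ` E)"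
    using Q by (simp add: cusp_curve_def quotientI)
qed

lemma cusp_curve_image:
  assumes "d > 0" "is_period_domain d D" "g \<in> Gamma d"
    and "prim_isotropic d 2 E" "prim_isotropic d 2 ((\<lambda>z. g *v z) ` E)"
  shows "cusp_curve d (Gamma d) D ((\<lambda>z. g *v z) ` E) = cusp_curve d (Gamma d) D E"
proof
  obtain h where h: "h \<in> Gamma d" "h ** g = mat 1" using Gamma_inverse[OF assms(1,3)] by blast
  \<comment> \<open>The reverse inclusion is the same lemma applied to the inverse of g and the
    image plane.\<close>
  then have "(\<lambda>z. h *v z) ` (\<lambda>z. g *v z) ` E = E"
    unfolding image_image matrix_vector_mul_assoc by simp
  then show "cusp_curve d (Gamma d) D ((\<lambda>z. g *v z) ` E) \<subseteq> cusp_curve d (Gamma d) D E"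
    using cusp_curve_image_subset[OF assms(1,2) h(1) assms(5)] assms(4) by simp
  show "cusp_curve d (Gamma d) D E \<subseteq> cusp_curve d (Gamma d) D ((\<lambda>z. g *v z) ` E)"
    by (rule cusp_curve_image_subset[OF assms])
qed

text \<open>The curves are covered by the pairs (q, k) with q in R and k < a: \<open>curve\<close>
  selects one plane for each normal form, and any other plane with that form is moved to it by
  \<open>Gamma\<close>. For pairs that no plane realises, the value of \<open>curve\<close> is
  arbitrary and merely enlarges the covering set.\<close>

lemma card_boundary_curves_le:
  fixes p :: nat
  assumes "prime p" "p > 3" "is_period_domain (p^2) D" "a > 0"
    and R: "finite R" "represents_classes \<Delta> R"
    and \<Delta>: "(int a)^2 * \<Delta> = - 12 * (int p)^2" "coprime (int a) \<Delta>"
  shows "finite (boundary_curves_of_type (p^2) (Gamma (p^2)) D a)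
    \<and> card (boundary_curves_of_type (p^2) (Gamma (p^2)) D a) \<le> card R * a"
proof -
  let ?d = "p^2"
  let ?C = "boundary_curves_of_type ?d (Gamma ?d) D a"
  have d: "?d > 0" using assms(2) by simp
  define normal where "normal k q E \<longleftrightarrow> prim_isotropic ?d 2 E \<and>
      (\<exists>e1 f2 e2 f1 x y. normal_basis ?d a k q E e1 f2 e2 f1 x y)" for k q E
  define curve where "curve = (\<lambda>(q, k). cusp_curve ?d (Gamma ?d) D (SOME E. normal k q E))"
  have "?C \<subseteq> curve ` (R \<times> {..<a})"
  proof
    fix c assume "c \<in> ?C"
    then obtain E where E: "prim_isotropic ?d 2 E" "has_type ?d a E" "c = cusp_curve ?d (Gamma ?d) D E"
      unfolding boundary_curves_of_type_def by blast
    obtain e1 f2 e2 f1 x y where fb: "flag_basis ?d a E e1 f2 e2 f1 x y"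
      using ex_flag_basis[OF E(1,2)] by blast
    obtain A B C where ABC: "form ?d x x = - 2 * of_int A" "form ?d x y = - of_int B"
        "form ?d y y = - 2 * of_int C"
      and pd: "bqf_posdef (A, B, C)" and det: "(int a)^2 * (4 * A * C - B^2) = 12 * int ?d"
      using flag_basis_binary_form[OF fb d assms(4)] by blast
    have "(int a)^2 * (4 * A * C - B^2) = (int a)^2 * (- \<Delta>)" using det \<Delta>(1) by simp
    then have disc: "4 * A * C - B^2 = - \<Delta>" using assms(4) unfolding mult_cancel_left by simp
    then have "(A, B, C) \<in> bqf_posdef_forms \<Delta>" using pd by (simp add: bqf_posdef_forms_def bqf_disc_def)
    then obtain q where q: "q \<in> R" "proper_equiv (A, B, C) q"
      using R(2) unfolding represents_classes_def by blast
    have "coprime (int a) (4 * A * C - B^2)" using \<Delta>(2) disc by simp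
    then obtain k where k: "k < a" "normal k q E"
      using ex_normal_basis[OF fb assms(4) ABC _ q(2)] E(1) unfolding normal_def by blast
    define E' where "E' = (SOME E. normal k q E)"
    have "normal k q E'" unfolding E'_def using k(2) by (rule someI)
    then obtain g where g: "g \<in> Gamma ?d" "(\<lambda>z. g *v z) ` E = E'"
      using ex_Gamma_of_same_normal_form[OF assms(1,2,4)] k(2) unfolding normal_def by blast
    have "prim_isotropic ?d 2 E'" using \<open>normal k q E'\<close> by (simp add: normal_def)
    then have "c = cusp_curve ?d (Gamma ?d) D E'"
      using cusp_curve_image[OF d assms(3) g(1) E(1)] E(3) g(2) by simp
    then have "c = curve (q, k)" by (simp add: curve_def E'_def)
    then show "c \<in> curve ` (R \<times> {..<a})" using q(1) k(1) by blast
  qed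
  moreover have "finite (R \<times> {..<a})" using R(1) by simp
  moreover have "card (curve ` (R \<times> {..<a})) \<le> card R * a"
    using card_image_le[OF \<open>finite (R \<times> {..<a})\<close>, of curve] by (simp add: card_cartesian_product)
  ultimately show ?thesis by (meson card_mono finite_imageI finite_subset order_trans)
qed

theorem corollary3p9:
  fixes p :: nat and D :: "(complex ^ 6) set set"
  assumes "prime p" and "p > 3"
    and "is_period_domain (p^2) D"
  shows "let C = boundary_curves_of_type (p^2) (Gamma (p^2)) D in
     (finite (C 1) \<and> card (C 1) \<le> 4 * class_number (- 48 * (int p)^2)) \<and>
     (finite (C 2) \<and> card (C 2) \<le> 128 * class_number (- 12 * (int p)^2)) \<and>
     (finite (C p) \<and> card (C p) \<le> 8 * p) \<and>
     (finite (C (2 * p)) \<and> card (C (2 * p)) \<le> 4 * (2 * p))"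
proof -
  note bound = card_boundary_curves_le[OF assms]
  have pp: "prime (int p)" using assms(1) by simp
  have "odd (int p)" using prime_odd_int[OF pp] assms(2) by simp
  \<comment> \<open>Together with 3 being prime to p, this makes a prime to its discriminant: 2 to
    -3p^2, p to -12 and 2p to -3.\<close>
  then have c2: "coprime 2 (int p)" by simp
  have "prime (3::int)" by simp
  then have "coprime 3 (int p)" using primes_coprime[OF _ pp, of 3] assms(2) by simp
  then have c3: "coprime (int p) 3" by (simp add: coprime_commute)
  have "coprime (int p) (2 * 2 * 3)" using c2 c3 by (simp only: coprime_mult_right_iff) (simp add: coprime_commute)
  then have c12: "coprime (int p) 12" by simp
  obtain R1 where R1: "finite R1" "card R1 \<le> 4 * class_number (- 48 * (int p)^2)"
    "represents_classes (- 12 * (int p)^2) R1" using ex_representatives_12_p_squared[OF assms(1)] by blast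
  obtain R2 where R2: "finite R2" "card R2 \<le> 2 * class_number (- 12 * (int p)^2)"
    "represents_classes (- 3 * (int p)^2) R2" using ex_representatives_3_p_squared[OF assms(1)] by blast
  have 1: "finite (boundary_curves_of_type (p^2) (Gamma (p^2)) D 1)
      \<and> card (boundary_curves_of_type (p^2) (Gamma (p^2)) D 1) \<le> card R1 * 1"
    by (rule bound[OF _ R1(1,3)]) simp_all
  have 2: "finite (boundary_curves_of_type (p^2) (Gamma (p^2)) D 2)
      \<and> card (boundary_curves_of_type (p^2) (Gamma (p^2)) D 2) \<le> card R2 * 2"
    by (rule bound[OF _ R2(1,3)]) (use c2 in simp_all)
  have 3: "finite (boundary_curves_of_type (p^2) (Gamma (p^2)) D p)
      \<and> card (boundary_curves_of_type (p^2) (Gamma (p^2)) D p)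
        \<le> card {(1::int, 0::int, 3::int), (2, 2, 2), (2, -2, 2)} * p"
    by (rule bound[OF _ _ represents_classes_12]) (use c12 assms(2) in simp_all)
  have 4: "finite (boundary_curves_of_type (p^2) (Gamma (p^2)) D (2 * p))
      \<and> card (boundary_curves_of_type (p^2) (Gamma (p^2)) D (2 * p))
        \<le> card {(1::int, 1::int, 1::int), (1, -1, 1)} * (2 * p)"
    by (rule bound[OF _ _ represents_classes_3])
      (use c3 assms(2) in \<open>simp_all add: power_mult_distrib\<close>)
  \<comment> \<open>The counts obtained are 4h(-48p^2), 4h(-12p^2), 3p and 4p; the last three lie
    below the bounds 128h(-12p^2), 8p and 8p.\<close>
  show ?thesis using 1 2 3 4 R1(2) R2(2) by (simp add: Let_def)
qed

end
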